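(* For each $\lambda>0$, let $\nu_{n,\lambda}$ be the empirical spectral distribution of $\frac{1}{\sqrt{\lambda}}M_{n,\lambda/n}$, where $M_{n,\lambda/n}$ is the adjacency matrix of the Erdős–Rényi random graph $G(n,\lambda/n)$, and let $\nu_\lambda:=\lim_{n\to\infty}\nu_{n,\lambda}$, where the limit is in the sense of weak convergence of probability measures. Then, as $\lambda\to\infty$, $\nu_\lambda$ converges weakly to the standard semicircle distribution $$\rho_{sc}(dx)=\frac{1}{2\pi}\sqrt{4-x^2}\,\mathbf{1}_{\{|x|\le 2\}}\,dx .$$
   Context: For $p\in[0,1]$, $M_{n,p}$ is the adjacency matrix of the Erdős–Rényi graph $G(n,p)$: the random symmetric $n\times n$ matrix with zero diagonal whose entries $M_{n,p}(i,j)$, $i>j$, are independent and equal to $1$ with probability $p$ and $0$ with probability $1-p$. For fixed $\lambda>0$ the matrix $M_{n,\lambda/n}$ is considered for $n\ge\lambda$. All random matrices are defined on a common probability space. The empirical spectral distribution of a real symmetric $n\times n$ matrix with eigenvalues $\Lambda_1\le\cdots\le\Lambda_n$ is the probability measure $\frac1n\sum_{i=1}^n\delta_{\Lambda_i}$ on $\mathbb{R}$. It is known (and may be taken as given) that for every fixed $\lambda>0$, almost surely, $\nu_{n,\lambda}$ converges weakly as $n\to\infty$ to a deterministic probability measure $\nu_\lambda$ on $\mathbb{R}$. *)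

theory Defs
  imports "HOL-Probability.Probability" "Jordan_Normal_Form.Char_Poly"
begin

text \<open>The entry \<open>(i, j)\<close> is \<open>M \<omega> $$ (i, j)\<close>; indices run from \<open>0\<close> to \<open>n - 1\<close>. Measurability of
  the strictly lower triangular entries is part of \<open>indep_vars\<close>.\<close>

definition erdos_renyi_adjacency ::
    "'w measure \<Rightarrow> nat \<Rightarrow> real \<Rightarrow> ('w \<Rightarrow> real mat) \<Rightarrow> bool" where
  "erdos_renyi_adjacency \<Omega> n p M \<longleftrightarrow>
     (\<forall>\<omega>\<in>space \<Omega>. M \<omega> \<in> carrier_mat n n \<and> transpose_mat (M \<omega>) = M \<omega> \<and>
        (\<forall>i<n. M \<omega> $$ (i, i) = 0)) \<and>
     prob_space.indep_vars \<Omega> (\<lambda>_. borel) (\<lambda>(i, j) \<omega>. M \<omega> $$ (i, j)) {(i, j). j < i \<and> i < n} \<and>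
     (\<forall>i j. j < i \<and> i < n \<longrightarrow>
        measure \<Omega> {\<omega>\<in>space \<Omega>. M \<omega> $$ (i, j) = 1} = p \<and>
        measure \<Omega> {\<omega>\<in>space \<Omega>. M \<omega> $$ (i, j) = 0} = 1 - p)"

text \<open>For a real symmetric \<open>n \<times> n\<close> matrix all \<open>n\<close> roots of the characteristic polynomial are real
  and their multiplicities are those of the eigenvalues, so this is the list
  \<open>\<Lambda>\<^sub>1 \<le> \<dots> \<le> \<Lambda>\<^sub>n\<close>. It is only meant for symmetric matrices.\<close>

definition real_eigenvalues :: "real mat \<Rightarrow> real list" where
  "real_eigenvalues A = sorted_list_of_multiset (proots (char_poly A))"

text \<open>The measure \<open>(1/n) \<Sum>\<^sub>i \<delta>\<close> with atoms at the \<open>\<Lambda>\<^sub>i\<close>, written as the law of \<open>\<Lambda>\<^sub>i\<close> for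
  \<open>i\<close> uniform on the \<open>n\<close> indices.\<close>

definition empirical_spectral_distribution :: "real mat \<Rightarrow> real measure" where
  "empirical_spectral_distribution A =
     distr (uniform_count_measure {..<dim_row A}) borel (\<lambda>i. real_eigenvalues A ! i)"

lemma measure_empirical_spectral_distribution:
  assumes "B \<in> sets borel"
  shows "measure (empirical_spectral_distribution A) B =
    real (card {i. i < dim_row A \<and> real_eigenvalues A ! i \<in> B}) / real (dim_row A)"
proof -
  have "measure (empirical_spectral_distribution A) B =
      measure (uniform_count_measure {..<dim_row A}) {i\<in>{..<dim_row A}. real_eigenvalues A ! i \<in> B}"
    unfolding empirical_spectral_distribution_def using assms
    by (subst measure_distr)
       (auto simp: space_uniform_count_measure measurable_def sets_uniform_count_measure
             intro!: arg_cong[where f = "measure _"])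
  also have "\<dots> = real (card {i\<in>{..<dim_row A}. real_eigenvalues A ! i \<in> B}) / real (dim_row A)"
    by (subst measure_uniform_count_measure) auto
  finally show ?thesis by simp
qed

definition semicircle_distribution :: "real measure" where
  "semicircle_distribution =
     density lborel (\<lambda>x. ennreal (1 / (2 * pi) * sqrt (4 - x\<^sup>2) * indicator {x. \<bar>x\<bar> \<le> 2} x))"

text \<open>The constant \<^const>\<open>weak_conv_m\<close> only covers families indexed by \<^typ>\<open>nat\<close>; here the
  family may be indexed by any type, e.g. by a real parameter tending to infinity.\<close>

definition weakly_tendsto :: "('i \<Rightarrow> real measure) \<Rightarrow> real measure \<Rightarrow> 'i filter \<Rightarrow> bool" where
  "weakly_tendsto \<mu> \<rho> F \<longleftrightarrow>
     (\<forall>f :: real \<Rightarrow> real. continuous_on UNIV f \<and> bounded (range f) \<longrightarrow>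
        ((\<lambda>i. integral\<^sup>L (\<mu> i) f) \<longlongrightarrow> integral\<^sup>L \<rho> f) F)"

lemma weakly_tendsto_sequentially_iff_weak_conv_m:
  assumes "\<And>n. real_distribution (\<mu> n)" "real_distribution \<rho>"
  shows "weakly_tendsto \<mu> \<rho> sequentially \<longleftrightarrow> weak_conv_m \<mu> \<rho>"
proof
  assume w: "weakly_tendsto \<mu> \<rho> sequentially"
  show "weak_conv_m \<mu> \<rho>"
  proof (rule integral_bdd_continuous_conv_imp_weak_conv[OF assms])
    fix f :: "real \<Rightarrow> real"
    assume f: "\<And>x. isCont f x" "\<And>x. \<bar>f x\<bar> \<le> 1"
    have "bounded (range f)"
      using f(2) by (auto intro!: boundedI[where B = 1])
    moreover have "continuous_on UNIV f"
      using f(1) by (simp add: continuous_at_imp_continuous_on)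
    ultimately show "(\<lambda>n. integral\<^sup>L (\<mu> n) f) \<longlonglongrightarrow> integral\<^sup>L \<rho> f"
      using w by (auto simp: weakly_tendsto_def)
  qed
next
  assume w: "weak_conv_m \<mu> \<rho>"
  show "weakly_tendsto \<mu> \<rho> sequentially"
    unfolding weakly_tendsto_def
  proof (intro allI impI, elim conjE)
    fix f :: "real \<Rightarrow> real"
    assume f: "continuous_on UNIV f" "bounded (range f)"
    then obtain B where "\<And>x. norm (f x) \<le> B"
      by (auto simp: bounded_iff)
    moreover have "\<And>x. isCont f x"
      using f(1) by (simp add: continuous_on_eq_continuous_at)
    ultimately show "(\<lambda>n. integral\<^sup>L (\<mu> n) f) \<longlonglongrightarrow> integral\<^sup>L \<rho> f"
      using weak_conv_imp_integral_bdd_continuous_conv[OF assms w] by blast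
  qed
qed

end

theory Submission
  imports Defs "Jordan_Normal_Form.Schur_Decomposition"
begin

text \<open>
  The proof is by moments. The expected \<open>k\<close>-th moment of \<open>\<nu>\<^bsub>n,l\<^esub>\<close> is the sum over closed walks of
  length \<open>k\<close> in the complete graph of \<open>l\<^bsup>-k/2\<^esup> n\<^sup>-\<^sup>1 (l/n)\<^sup>e\<close>, where \<open>e\<close> is the number of distinct edges.
  A walk with \<open>v\<close> vertices has \<open>v \<le> e + 1\<close>, and there are \<open>O(n\<^sup>v)\<close> of them, so letting first \<open>n\<close> and
  then \<open>l\<close> tend to infinity only the walks with \<open>v = e + 1 = k/2 + 1\<close> survive. These are the contour
  walks around plane trees, and their shapes are counted by the Dyck paths of length \<open>k\<close>. The
  substitution \<open>x = 2 cos \<theta>\<close> shows that the semicircle moments satisfy the same recursion (that of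
  Chebyshev polynomials of the second kind), so no closed form for Catalan numbers is needed.

  As \<open>\<nu>\<^sub>l\<close> is only a weak limit, its moments are never used: for every even \<open>K\<close> the expected
  characteristic function of \<open>\<nu>\<^bsub>n,l\<^esub>\<close> is within \<open>2 |t|\<^sup>K / K!\<close> times its \<open>K\<close>-th moment of its Taylor
  polynomial, uniformly in \<open>n\<close>, and characteristic functions pass to the limit by dominated
  convergence. Levy's continuity theorem concludes.
\<close>

subsection \<open>Walks and contour walks\<close>

text \<open>A walk is the list of its vertices in reverse order: the head is the current vertex and the
  last element is the root.\<close>

fun walk_edges :: "'a list \<Rightarrow> 'a set set" where
  "walk_edges (y # x # ws) = insert {x, y} (walk_edges (x # ws))"
| "walk_edges _ = {}"

text \<open>The vertex from which a vertex was first reached, and the number of such steps back to the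
  root. Outside the walk the values are junk.\<close>

fun parent :: "'a list \<Rightarrow> 'a \<Rightarrow> 'a" where
  "parent (y # x # ws) =
     (if y \<in> set (x # ws) then parent (x # ws) else (parent (x # ws))(y := x))"
| "parent _ = id"

fun depth :: "'a list \<Rightarrow> 'a \<Rightarrow> nat" where
  "depth (y # x # ws) =
     (if y \<in> set (x # ws) then depth (x # ws)
      else (depth (x # ws))(y := Suc (depth (x # ws) x)))"
| "depth _ = (\<lambda>_. 0)"

text \<open>The walks around a growing plane tree: every step explores a new vertex or backtracks to the
  parent.\<close>

fun contour :: "'a list \<Rightarrow> bool" where
  "contour (y # x # ws) \<longleftrightarrow> contour (x # ws) \<and>
     (y \<notin> set (x # ws) \<or> 0 < depth (x # ws) x \<and> y = parent (x # ws) x)"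
| "contour [x] \<longleftrightarrow> True"
| "contour [] \<longleftrightarrow> False"

lemma finite_walk_edges [simp]: "finite (walk_edges ws)"
  by (induction ws rule: walk_edges.induct) auto

lemma walk_edges_subset: "e \<in> walk_edges ws \<Longrightarrow> e \<subseteq> set ws"
  by (induction ws rule: walk_edges.induct) auto

text \<open>Only the root keeps the initial value 0; every other vertex receives a successor when it
  is first reached, and values of old vertices never change. Hence depth 0 at the current vertex
  means that the walk is closed.\<close>

lemma depth_eq_0_iff:
  "v \<in> set ws \<Longrightarrow> depth ws v = 0 \<longleftrightarrow> v = last ws"
proof (induction ws rule: depth.induct)
  case (1 y x ws)
  moreover have "last (x # ws) \<in> set (x # ws)" by (rule last_in_set) simp
  ultimately show ?case
    by (cases "y \<in> set (x # ws)"; cases "v = y") (auto simp del: last.simps simp add: last_ConsR)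
qed auto

text \<open>Positive depth excludes the root, where \<open>parent\<close> carries no
  information.\<close>

lemma parent_in_set:
  assumes "v \<in> set ws" "0 < depth ws v"
  shows "parent ws v \<in> set ws \<and> Suc (depth ws (parent ws v)) = depth ws v"
  using assms
proof (induction ws rule: depth.induct)
  case (1 y x ws)
  show ?case
  proof (cases "y \<in> set (x # ws)")
    case True
    then show ?thesis using 1 by auto
  next
    case False
    show ?thesis
    proof (cases "v = y")
      case True
      then show ?thesis using False by auto
    next
      case vy: False
      have "parent (x # ws) v \<in> set (x # ws) \<and> Suc (depth (x # ws) (parent (x # ws) v)) = depth (x # ws) v"
        using 1 False vy by auto
      then show ?thesis using False vy
        by (metis depth.simps(1) fun_upd_other list.set_intros(2) parent.simps(1))
    qed
  qed
qed auto

lemma insert_notin_walk_edges: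
  "y \<notin> set (x # ws) \<Longrightarrow> {x, y} \<notin> walk_edges (x # ws)"
  using walk_edges_subset[of "{x, y}" "x # ws"] by auto

text \<open>Each newly reached vertex brings an edge that was not there before; only the root comes
  without one.\<close>

lemma card_set_le_Suc_card_walk_edges: "card (set ws) \<le> Suc (card (walk_edges ws))"
proof (induction ws rule: walk_edges.induct)
  case (1 y x ws)
  show ?case
  proof (cases "y \<in> set (x # ws)")
    case True
    then have "set (y # x # ws) = set (x # ws)" by auto
    moreover have "card (walk_edges (x # ws)) \<le> card (walk_edges (y # x # ws))"
      by (rule card_mono) auto
    ultimately show ?thesis using 1 by simp
  next
    case False
    then show ?thesis using 1 insert_notin_walk_edges[OF False] by simp
  qed
qed auto

text \<open>The equality case of the previous bound passes to shorter walks: a step to an old vertex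
  along a new edge would close a cycle and spoil equality for good.\<close>

lemma tree_walk_Cons:
  assumes "card (set (y # x # ws)) = Suc (card (walk_edges (y # x # ws)))"
  shows "card (set (x # ws)) = Suc (card (walk_edges (x # ws)))"
    and "y \<notin> set (x # ws) \<or> {x, y} \<in> walk_edges (x # ws)"
proof -
  have *: "card (set (x # ws)) \<le> Suc (card (walk_edges (x # ws)))"
    by (rule card_set_le_Suc_card_walk_edges)
  have "card (set (x # ws)) = Suc (card (walk_edges (x # ws))) \<and>
    (y \<notin> set (x # ws) \<or> {x, y} \<in> walk_edges (x # ws))"
  proof (cases "y \<in> set (x # ws)")
    case True
    then have "set (y # x # ws) = set (x # ws)" by auto
    with assms * show ?thesis by (auto simp: card_insert_if split: if_splits)
  next
    case False
    then show ?thesis using assms insert_notin_walk_edges[OF False] by simp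
  qed
  then show "card (set (x # ws)) = Suc (card (walk_edges (x # ws)))"
    and "y \<notin> set (x # ws) \<or> {x, y} \<in> walk_edges (x # ws)" by auto
qed

text \<open>In a tree walk an edge can only appear when one of its endpoints is first reached, and
  then the other endpoint becomes its parent.\<close>

lemma tree_walk_edge_cases:
  assumes "card (set ws) = Suc (card (walk_edges ws))" "{a, b} \<in> walk_edges ws"
  shows "depth ws a = Suc (depth ws b) \<and> parent ws a = b \<or>
    depth ws b = Suc (depth ws a) \<and> parent ws b = a"
  using assms
proof (induction ws rule: walk_edges.induct)
  case (1 y x ws)
  note tw = tree_walk_Cons[OF 1(2)]
  note IH = "1.IH"[OF tw(1)]
  show ?case
  proof (cases "y \<in> set (x # ws)")
    case True
    with tw have "walk_edges (y # x # ws) = walk_edges (x # ws)" by auto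
    then have "{a, b} \<in> walk_edges (x # ws)" using 1(3) by simp
    from IH[OF this] show ?thesis using True by simp
  next
    case False
    show ?thesis
    proof (cases "{a, b} = {x, y}")
      case True
      then show ?thesis using False by (auto simp: doubleton_eq_iff)
    next
      case ab: False
      then have e: "{a, b} \<in> walk_edges (x # ws)" using 1(3) by simp
      with walk_edges_subset[OF this] False have "a \<noteq> y" "b \<noteq> y" by auto
      then show ?thesis using IH[OF e] False by simp
    qed
  qed
qed auto

text \<open>Exploring and backtracking keep \<open>2 e - t - depth\<close> constant (\<open>e\<close> edges after \<open>t\<close> steps);
  walking away from the root along an old edge decreases it by two.\<close>

lemma tree_walk_card_edges_le:
  assumes "ws \<noteq> []" "card (set ws) = Suc (card (walk_edges ws))"
  shows "Suc (2 * card (walk_edges ws)) \<le> length ws + depth ws (hd ws) \<and>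
    (Suc (2 * card (walk_edges ws)) = length ws + depth ws (hd ws) \<longrightarrow> contour ws)"
  using assms
proof (induction ws rule: walk_edges.induct)
  case (1 y x ws)
  note tw = tree_walk_Cons[OF 1(3)]
  note IH = "1.IH"[OF _ tw(1)]
  show ?case
  proof (cases "y \<in> set (x # ws)")
    case True
    then have "{x, y} \<in> walk_edges (x # ws)" using tw by simp
    from insert_absorb[OF this]
    have e: "walk_edges (y # x # ws) = walk_edges (x # ws)" by simp
    from True have d: "depth (y # x # ws) y = depth (x # ws) y" by simp
    from tree_walk_edge_cases[OF tw(1) \<open>{x, y} \<in> walk_edges (x # ws)\<close>] show ?thesis
    proof
      assume "depth (x # ws) x = Suc (depth (x # ws) y) \<and> parent (x # ws) x = y"
      then show ?thesis using IH d unfolding e by simp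
    next
      assume "depth (x # ws) y = Suc (depth (x # ws) x) \<and> parent (x # ws) y = x"
      then show ?thesis using IH d unfolding e by simp
    qed
  next
    case False
    then show ?thesis using IH insert_notin_walk_edges[OF False] by auto
  qed
qed auto

lemma parent_edge:
  "v \<in> set ws \<Longrightarrow> 0 < depth ws v \<Longrightarrow> {v, parent ws v} \<in> walk_edges ws"
proof (induction ws rule: walk_edges.induct)
  case (1 y x ws)
  show ?case
  proof (cases "v \<in> set (x # ws)")
    case True
    then have "parent (y # x # ws) v = parent (x # ws) v" "depth (y # x # ws) v = depth (x # ws) v"
      by auto
    then show ?thesis using 1 True by simp
  next
    case False
    then show ?thesis using 1 by auto
  qed
qed auto

text \<open>A converse to the previous bound. Exploring adds 1 to the edges, the time and the depth;
  backtracking adds 1 to the time, removes 1 from the depth and uses an old edge. So twice the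
  number of edges equals time plus depth throughout.\<close>

lemma contourD:
  assumes "contour ws"
  shows "distinct_adj ws" "card (set ws) = Suc (card (walk_edges ws))"
    "Suc (2 * card (walk_edges ws)) = length ws + depth ws (hd ws)"
proof -
  have "distinct_adj ws \<and> card (set ws) = Suc (card (walk_edges ws)) \<and>
    Suc (2 * card (walk_edges ws)) = length ws + depth ws (hd ws)"
    using assms
  proof (induction ws rule: contour.induct)
    case (1 y x ws)
    then have IH: "distinct_adj (x # ws)" "card (set (x # ws)) = Suc (card (walk_edges (x # ws)))"
      "Suc (2 * card (walk_edges (x # ws))) = length (x # ws) + depth (x # ws) x" by simp_all
    show ?case
    proof (cases "y \<in> set (x # ws)")
      case True
      then have d: "0 < depth (x # ws) x" "y = parent (x # ws) x" using 1(2) by auto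
      then have e: "{x, y} \<in> walk_edges (x # ws)" using parent_edge[of x "x # ws"] by simp
      from True have s: "set (y # x # ws) = set (x # ws)" by auto
      have p: "Suc (depth (x # ws) y) = depth (x # ws) x" 
        using parent_in_set[of x "x # ws"] d by simp
      then have "y \<noteq> x" by auto
      moreover have "depth (y # x # ws) (hd (y # x # ws)) = depth (x # ws) y"
        using True by simp
      moreover have "walk_edges (y # x # ws) = walk_edges (x # ws)"
        using e by auto
      ultimately show ?thesis using IH p unfolding s by simp
    next
      case False
      then show ?thesis using IH insert_notin_walk_edges[OF False] by auto
    qed
  qed auto
  then show "distinct_adj ws" "card (set ws) = Suc (card (walk_edges ws))"
    "Suc (2 * card (walk_edges ws)) = length ws + depth ws (hd ws)" by auto
qed

text \<open>These are the lattice paths with \<open>t\<close> steps up or down by 1 from height 0 to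
  height \<open>h\<close> that never go below 0, split by the last step. For \<open>h = 0\<close>
  and even \<open>t\<close> they are the Dyck paths, counted by the Catalan numbers.\<close>

fun ballot_paths :: "nat \<Rightarrow> nat \<Rightarrow> nat" where
  "ballot_paths 0 h = (if h = 0 then 1 else 0)"
| "ballot_paths (Suc t) h = (if h = 0 then 0 else ballot_paths t (h - 1)) + ballot_paths t (Suc h)"

definition contours :: "'a set \<Rightarrow> nat \<Rightarrow> nat \<Rightarrow> 'a list set" where
  "contours V t h = {ws. set ws \<subseteq> V \<and> length ws = Suc t \<and> contour ws \<and> depth ws (hd ws) = h}"

lemma finite_contours: "finite V \<Longrightarrow> finite (contours V t h)"
  by (rule finite_subset[OF _ finite_lists_length_eq[of V "Suc t"]]) (auto simp: contours_def)

text \<open>The split by the last step matches that of \<open>ballot_paths\<close>: a new vertex is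
  entered from depth \<open>h - 1\<close>, with a free choice outside the walk; a return to the
  parent comes from depth \<open>h + 1\<close> and leaves no choice.\<close>

lemma contours_Suc:
  "contours V (Suc t) h =
     (\<lambda>(ws, y). y # ws) ` (SIGMA ws : (if h = 0 then {} else contours V t (h - 1)). V - set ws) \<union>
     (\<lambda>ws. parent ws (hd ws) # ws) ` contours V t (Suc h)" (is "_ = ?F \<union> ?P")
proof (intro equalityI subsetI)
  fix zs assume zs: "zs \<in> contours V (Suc t) h"
  then obtain y x ws where [simp]: "zs = y # x # ws"
    by (auto simp: contours_def length_Suc_conv)
  show "zs \<in> ?F \<union> ?P"
  proof (cases "y \<in> set (x # ws)")
    case True
    then have d: "0 < depth (x # ws) x" "y = parent (x # ws) x"
      using zs by (auto simp: contours_def)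
    then have "Suc (depth (x # ws) y) = depth (x # ws) x"
      using parent_in_set[of x "x # ws"] by simp
    moreover have "depth (x # ws) y = h" using zs True by (simp add: contours_def split: if_splits)
    ultimately have "x # ws \<in> contours V t (Suc h)"
      using zs by (simp add: contours_def)
    then have "zs \<in> ?P" using d by (intro image_eqI[of _ _ "x # ws"]) auto
    then show ?thesis by blast
  next
    case False
    then have "x # ws \<in> contours V t (h - 1)" "h \<noteq> 0" "y \<in> V"
      using zs by (auto simp: contours_def)
    then have "(x # ws, y) \<in> (SIGMA ws : (if h = 0 then {} else contours V t (h - 1)). V - set ws)"
      using False by simp
    then show ?thesis by (auto intro!: image_eqI[of _ _ "(x # ws, y)"])
  qed
next
  fix zs assume "zs \<in> ?F \<union> ?P"
  then consider (F) ws y where "zs = y # ws" "h \<noteq> 0" "ws \<in> contours V t (h - 1)" "y \<in> V" "y \<notin> set ws"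
    | (P) ws where "zs = parent ws (hd ws) # ws" "ws \<in> contours V t (Suc h)"
    by (auto split: if_splits)
  then show "zs \<in> contours V (Suc t) h"
  proof cases
    case F
    then obtain x us where "ws = x # us" by (auto simp: contours_def length_Suc_conv)
    then show ?thesis using F by (auto simp: contours_def)
  next
    case P
    then obtain x us where [simp]: "ws = x # us" by (auto simp: contours_def length_Suc_conv)
    have d: "depth (x # us) x = Suc h" using P by (simp add: contours_def)
    with parent_in_set[of x "x # us"]
    have "parent (x # us) x \<in> set (x # us)" "depth (x # us) (parent (x # us) x) = h" by auto
    then show ?thesis using P d by (auto simp: contours_def)
  qed
qed

text \<open>A contour walk of \<open>t\<close> steps at depth \<open>h\<close> has seen \<open>(t + h) / 2 + 1\<close> vertices, and its depth
  profile is a nonnegative path from \<open>0\<close> to \<open>h\<close>.\<close>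

lemma card_contours:
  assumes "finite V"
  shows "real (card (contours V t h)) =
    real (ballot_paths t h) * (\<Prod>i<Suc ((t + h) div 2). real (card V) - real i)"
proof (induction t arbitrary: h)
  case 0
  have "contours V 0 h = (if h = 0 then (\<lambda>x. [x]) ` V else {})"
    by (auto simp: contours_def length_Suc_conv)
  moreover have "card ((\<lambda>x. [x]) ` V) = card V" by (simp add: card_image inj_on_def)
  ultimately show ?case by simp
next
  case (Suc t)
  let ?F = "(\<lambda>(ws, y). y # ws) ` (SIGMA ws : (if h = 0 then {} else contours V t (h - 1)). V - set ws)"
  let ?P = "(\<lambda>ws. parent ws (hd ws) # ws) ` contours V t (Suc h)"
  have fin: "finite (if h = 0 then {} else contours V t (h - 1))"
    using assms finite_contours by auto
  \<comment> \<open>A parent is an old vertex, so no walk arises in both ways.\<close>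
  have disj: "?F \<inter> ?P = {}"
  proof -
    { fix ws assume "ws \<in> contours V t (Suc h)" "parent ws (hd ws) \<notin> set ws"
      then have False using parent_in_set[of "hd ws" ws] by (cases ws) (auto simp: contours_def) }
    then show ?thesis by auto
  qed
  have P: "real (card ?P) = real (ballot_paths t (Suc h)) *
      (\<Prod>i<Suc ((Suc t + h) div 2). real (card V) - real i)"
  proof -
    have "card ?P = card (contours V t (Suc h))"
      by (rule card_image) (auto simp: inj_on_def)
    then show ?thesis using Suc.IH[of "Suc h"] by simp
  qed
  have F: "real (card ?F) = (if h = 0 then 0 else real (ballot_paths t (h - 1))) *
      (\<Prod>i<Suc ((Suc t + h) div 2). real (card V) - real i)"
  proof (cases h)
    case 0
    then show ?thesis by simp
  next
    case (Suc h')
    have "card ?F = card (SIGMA ws : contours V t h'. V - set ws)"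
      unfolding Suc by (subst card_image) (auto simp: inj_on_def)
    also have "\<dots> = (\<Sum>ws\<in>contours V t h'. card (V - set ws))"
      using assms finite_contours by (subst card_SigmaI) auto
    finally have "real (card ?F) = (\<Sum>ws\<in>contours V t h'. real (card (V - set ws)))" by simp
    \<comment> \<open>All these walks have the same number of vertices, so the number of choices for
      the next new vertex does not depend on the walk. It is the next factor of the falling
      product.\<close>
    also have "\<dots> = (\<Sum>ws\<in>contours V t h'. real (card V) - real (Suc ((t + h') div 2)))"
    proof (rule sum.cong[OF refl])
      fix ws assume ws: "ws \<in> contours V t h'"
      then have c: "card (set ws) = Suc (card (walk_edges ws))"
        "Suc (2 * card (walk_edges ws)) = Suc t + h'"
        using contourD[of ws] by (auto simp: contours_def)
      then have "card (set ws) = Suc ((t + h') div 2)" by auto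
      moreover have "set ws \<subseteq> V" using ws by (auto simp: contours_def)
      ultimately show "real (card (V - set ws)) = real (card V) - real (Suc ((t + h') div 2))"
        using assms card_mono[OF assms, of "set ws"] by (simp add: card_Diff_subset of_nat_diff)
    qed
    also have "\<dots> = real (card (contours V t h')) * (real (card V) - real (Suc ((t + h') div 2)))"
      by simp
    also have "\<dots> = real (ballot_paths t h') * (\<Prod>i<Suc (Suc ((t + h') div 2)). real (card V) - real i)"
      by (simp add: Suc.IH[of h'])
    also have "Suc (Suc ((t + h') div 2)) = Suc ((Suc t + h) div 2)" using Suc by simp
    finally show ?thesis using Suc by simp
  qed
  have "card (contours V (Suc t) h) = card ?F + card ?P"
    unfolding contours_Suc using disj assms fin
    by (intro card_Un_disjoint) (auto simp: finite_contours)
  then show ?case using P F by (simp add: ring_distribs)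
qed

lemma ballot_paths_odd: "odd (t + h) \<Longrightarrow> ballot_paths t h = 0"
proof (induction t arbitrary: h)
  case (Suc t)
  then show ?case by (cases h) simp_all
qed (auto dest: odd_pos)

subsection \<open>Spectral moments of symmetric matrices\<close>

text \<open>The Hermitian form \<open>q\<close> of an eigenvector is its own conjugate by symmetry
  and equals \<open>z\<close> times the squared norm \<open>s\<close>, a nonzero real
  number.\<close>

lemma symmetric_mat_complex_eigenvalue_real:
  fixes A :: "real mat"
  assumes A: "A \<in> carrier_mat n n" "transpose_mat A = A"
    and ev: "eigenvalue (map_mat complex_of_real A) z"
  shows "z \<in> \<real>"
proof -
  obtain v where v: "v \<in> carrier_vec n" "v \<noteq> 0\<^sub>v n"
    and Av: "map_mat complex_of_real A *\<^sub>v v = z \<cdot>\<^sub>v v"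
    using ev A unfolding eigenvalue_def eigenvector_def by auto
  have sym: "A $$ (i, j) = A $$ (j, i)" if "i < n" "j < n" for i j
    using A that by (metis carrier_matD index_transpose_mat(1))
  have comp: "(\<Sum>j<n. of_real (A $$ (i, j)) * v $ j) = z * v $ i" if "i < n" for i
  proof -
    have "(map_mat complex_of_real A *\<^sub>v v) $ i = z * v $ i"
      using that v unfolding Av by simp
    then show ?thesis
      using that v A by (simp add: scalar_prod_def atLeast0LessThan)
  qed
  define s where "s = (\<Sum>i<n. v $ i * cnj (v $ i))"
  define q where "q = (\<Sum>i<n. \<Sum>j<n. of_real (A $$ (i, j)) * v $ j * cnj (v $ i))"
  have q: "q = z * s"
  proof -
    have "q = (\<Sum>i<n. (\<Sum>j<n. of_real (A $$ (i, j)) * v $ j) * cnj (v $ i))"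
      unfolding q_def by (simp add: sum_distrib_right)
    then show ?thesis unfolding s_def by (simp add: comp sum_distrib_left mult.assoc)
  qed
  have "cnj q = (\<Sum>i<n. \<Sum>j<n. of_real (A $$ (i, j)) * cnj (v $ j) * v $ i)"
    unfolding q_def by simp
  also have "\<dots> = (\<Sum>j<n. \<Sum>i<n. of_real (A $$ (i, j)) * cnj (v $ j) * v $ i)"
    by (rule sum.swap)
  also have "\<dots> = q"
    unfolding q_def by (intro sum.cong refl) (auto simp: sym)
  finally have cq: "cnj q = q" .
  have cs: "cnj s = s" unfolding s_def by (simp add: mult.commute)
  have s: "s = of_real (\<Sum>i<n. (cmod (v $ i))\<^sup>2)"
    unfolding s_def of_real_sum by (simp only: complex_norm_square)
  have "s \<noteq> 0"
  proof
    assume "s = 0"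
    then have "(\<Sum>i<n. (cmod (v $ i))\<^sup>2) = 0" unfolding s by (simp only: of_real_eq_0_iff)
    then have "\<forall>i<n. v $ i = 0" by (subst (asm) sum_nonneg_eq_0_iff) auto
    then have "v = 0\<^sub>v n" using v by (intro eq_vecI) auto
    with v show False by simp
  qed
  moreover have "cnj z * s = z * s" using cq cs unfolding q by simp
  ultimately show ?thesis by (simp add: Reals_cnj_iff)
qed

text \<open>The characteristic polynomial splits over the complex numbers, all its roots are real,
  and the embedding of the reals is injective on coefficients.\<close>

lemma symmetric_char_poly_factorized:
  fixes A :: "real mat"
  assumes A: "A \<in> carrier_mat n n" "transpose_mat A = A"
  shows "\<exists>es. char_poly A = (\<Prod>e\<leftarrow>es. [:- e, 1:]) \<and> length es = n"
proof -
  let ?C = "map_mat complex_of_real A"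
  have C: "?C \<in> carrier_mat n n" using A by simp
  from char_poly_factorized[OF C] obtain as
    where as: "char_poly ?C = (\<Prod>a\<leftarrow>as. [:- a, 1:])" "length as = n" by auto
  have "a \<in> \<real>" if "a \<in> set as" for a
  proof -
    have "poly (char_poly ?C) a = 0"
      unfolding as poly_prod_list using that by (force simp: prod_list_zero_iff)
    then have "eigenvalue ?C a" using eigenvalue_root_char_poly[OF C] by simp
    then show ?thesis by (rule symmetric_mat_complex_eigenvalue_real[OF A])
  qed
  then have ev: "map (\<lambda>a. complex_of_real (Re a)) as = as"
    by (intro map_idI) (auto simp: Reals_def)
  have "map_poly complex_of_real (char_poly A) = char_poly ?C"
    by (rule of_real_hom.char_poly_hom[OF A(1), symmetric])
  also have "\<dots> = (\<Prod>a\<leftarrow>map (\<lambda>a. complex_of_real (Re a)) as. [:- a, 1:])"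
    unfolding ev as ..
  also have "\<dots> = map_poly complex_of_real (\<Prod>e\<leftarrow>map Re as. [:- e, 1:])"
  proof (induction as)
    case (Cons a as)
    have mult: "map_poly complex_of_real (p * q) = map_poly of_real p * map_poly of_real q" for p q
      by (intro poly_eqI) (simp add: coeff_map_poly coeff_mult)
    show ?case using Cons by (simp add: mult map_poly_pCons del: mult_pCons_left)
  qed simp
  finally have "char_poly A = (\<Prod>e\<leftarrow>map Re as. [:- e, 1:])"
    by (simp add: poly_eq_iff coeff_map_poly)
  with as(2) show ?thesis by (intro exI[of _ "map Re as"]) simp
qed

lemma mset_real_eigenvalues:
  fixes es :: "real list"
  assumes "char_poly A = (\<Prod>e\<leftarrow>es. [:- e, 1:])"
  shows "mset (real_eigenvalues A) = mset es"
proof -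
  have "proots (\<Prod>e\<leftarrow>es. [:- e, 1:]) = mset es" for es :: "real list"
  proof (induction es)
    case (Cons e es)
    have "(\<Prod>e\<leftarrow>es. [:- e, 1:]) \<noteq> 0" by (auto simp: prod_list_zero_iff)
    then have "proots ([:- e, 1:] * (\<Prod>e\<leftarrow>es. [:- e, 1:])) = proots [:- e, 1:] + mset es"
      using Cons by (subst proots_mult) auto
    then show ?case by simp
  qed simp
  then show ?thesis unfolding real_eigenvalues_def assms by simp
qed

text \<open>The entries below the diagonal are included because the induction uses that they vanish
  in the power as well as in \<open>B\<close>; only the term \<open>l = i\<close> of the product
  survives.\<close>

lemma upper_triangular_pow_mat:
  assumes "B \<in> carrier_mat n n" "upper_triangular B" "i < n" "j \<le> i"
  shows "(B ^\<^sub>m k) $$ (i, j) = (if j = i then (B $$ (i, i)) ^ k else (0 :: 'a :: comm_semiring_1))"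
  using assms(3,4)
proof (induction k arbitrary: i j)
  case 0
  then show ?case using assms by auto
next
  case (Suc k)
  have "(B ^\<^sub>m Suc k) $$ (i, j) = (\<Sum>l<n. (B ^\<^sub>m k) $$ (i, l) * B $$ (l, j))"
    using Suc.prems assms(1) by (simp add: scalar_prod_def atLeast0LessThan)
  also have "\<dots> = (\<Sum>l<n. if l = i then (B ^\<^sub>m k) $$ (i, i) * B $$ (i, j) else 0)"
  proof (rule sum.cong[OF refl])
    fix l assume l: "l \<in> {..<n}"
    consider "l < i" | "l = i" | "l > i" by linarith
    then show "(B ^\<^sub>m k) $$ (i, l) * B $$ (l, j) = (if l = i then (B ^\<^sub>m k) $$ (i, i) * B $$ (i, j) else 0)"
    proof cases
      case 1
      then show ?thesis using Suc.IH[of i l] Suc.prems by simp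
    next
      case 3
      then have "B $$ (l, j) = 0" using assms l Suc.prems by (intro upper_triangularD) auto
      then show ?thesis using 3 by simp
    qed simp
  qed
  also have "\<dots> = (B ^\<^sub>m k) $$ (i, i) * B $$ (i, j)" using Suc.prems by simp
  also have "\<dots> = (if j = i then (B $$ (i, i)) ^ Suc k else 0)"
    using Suc.prems Suc.IH[of i i] assms upper_triangularD[of B j i] by (auto simp: mult.commute)
  finally show ?case .
qed

definition mat_trace :: "'a :: comm_monoid_add mat \<Rightarrow> 'a" where
  "mat_trace A = (\<Sum>i<dim_row A. A $$ (i, i))"

lemma mat_trace_mult_commute:
  fixes A :: "'a :: comm_semiring_0 mat"
  assumes "A \<in> carrier_mat n m" "B \<in> carrier_mat m n"
  shows "mat_trace (A * B) = mat_trace (B * A)"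
proof -
  have "mat_trace (A * B) = (\<Sum>i<n. \<Sum>j<m. A $$ (i, j) * B $$ (j, i))"
    using assms by (simp add: mat_trace_def scalar_prod_def atLeast0LessThan)
  also have "\<dots> = (\<Sum>j<m. \<Sum>i<n. B $$ (j, i) * A $$ (i, j))"
    by (subst sum.swap) (simp add: mult.commute)
  also have "\<dots> = mat_trace (B * A)"
    using assms by (simp add: mat_trace_def scalar_prod_def atLeast0LessThan)
  finally show ?thesis .
qed

text \<open>Schur decomposition gives a similar upper triangular matrix with the eigenvalues on its
  diagonal, and the trace of a power is invariant under similarity. The length claim keeps every
  index \<open>i < n\<close> of the empirical distribution inside the list.\<close>

lemma symmetric_real_eigenvalues:
  fixes A :: "real mat"
  assumes A: "A \<in> carrier_mat n n" "transpose_mat A = A"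
  shows "length (real_eigenvalues A) = n"
    and "(\<Sum>e\<leftarrow>real_eigenvalues A. e ^ k) = mat_trace (A ^\<^sub>m k)"
proof -
  obtain es where es: "char_poly A = (\<Prod>e\<leftarrow>es. [:- e, 1:])" "length es = n"
    using symmetric_char_poly_factorized[OF A] by auto
  note m = mset_real_eigenvalues[OF es(1)]
  from m es show "length (real_eigenvalues A) = n" by (metis size_mset)
  obtain B P Q where "schur_decomposition A es = (B, P, Q)"
    by (cases "schur_decomposition A es") auto
  from schur_decomposition[OF A(1) es(1) this]
  have sim: "similar_mat_wit A B P Q" and ut: "upper_triangular B" and d: "diag_mat B = es" by auto
  from similar_mat_witD2[OF A(1) sim] have c: "B \<in> carrier_mat n n" "P \<in> carrier_mat n n"
    "Q \<in> carrier_mat n n" "Q * P = 1\<^sub>m n" by auto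
  have Bk: "B ^\<^sub>m k \<in> carrier_mat n n" using c by simp
  have "mat_trace (A ^\<^sub>m k) = mat_trace (P * (B ^\<^sub>m k * Q))"
    using similar_mat_wit_pow_id[OF sim, of k] c Bk by (simp add: assoc_mult_mat)
  also have "\<dots> = mat_trace (B ^\<^sub>m k * Q * P)"
    using c Bk by (intro mat_trace_mult_commute) auto
  also have "B ^\<^sub>m k * Q * P = B ^\<^sub>m k"
    using c Bk by (subst assoc_mult_mat) auto
  also have "mat_trace (B ^\<^sub>m k) = (\<Sum>i<n. (B $$ (i, i)) ^ k)"
    using c Bk upper_triangular_pow_mat[OF c(1) ut] by (simp add: mat_trace_def)
  also have "\<dots> = (\<Sum>e\<leftarrow>es. e ^ k)"
    unfolding d[symmetric] diag_mat_def using c 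
    by (simp add: sum_list_sum_nth atLeast0LessThan o_def)
  also have "\<dots> = sum_mset (image_mset (\<lambda>e. e ^ k) (mset es))"
    by (simp add: sum_mset_sum_list[symmetric])
  also have "\<dots> = (\<Sum>e\<leftarrow>real_eigenvalues A. e ^ k)"
    unfolding m[symmetric] by (simp add: sum_mset_sum_list[symmetric])
  finally show "(\<Sum>e\<leftarrow>real_eigenvalues A. e ^ k) = mat_trace (A ^\<^sub>m k)" ..
qed

section \<open>Moments of the empirical spectral distribution\<close>

lemma real_distribution_empirical_spectral_distribution:
  assumes "A \<in> carrier_mat n n" "0 < n"
  shows "real_distribution (empirical_spectral_distribution A)"
proof -
  have "prob_space (uniform_count_measure {..<n})"
    using assms by (intro prob_space_uniform_count_measure) auto
  then interpret prob_space "empirical_spectral_distribution A"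
    unfolding empirical_spectral_distribution_def using assms 
    by (auto intro!: prob_space.prob_space_distr simp: measurable_def space_uniform_count_measure sets_uniform_count_measure)
  show ?thesis
    by unfold_locales (auto simp: empirical_spectral_distribution_def)
qed

lemma
  fixes f :: "real \<Rightarrow> 'b :: {banach, second_countable_topology}"
  assumes A: "A \<in> carrier_mat n n" and f: "f \<in> borel_measurable borel"
  shows integral_empirical_spectral_distribution:
      "integral\<^sup>L (empirical_spectral_distribution A) f =
        (1 / real n) *\<^sub>R (\<Sum>i<n. f (real_eigenvalues A ! i))"
    and integrable_empirical_spectral_distribution:
      "integrable (empirical_spectral_distribution A) f"
proof -
  have m: "(\<lambda>i. real_eigenvalues A ! i) \<in> measurable (uniform_count_measure {..<dim_row A}) borel"
    by (auto simp: measurable_def space_uniform_count_measure sets_uniform_count_measure)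
  show "integral\<^sup>L (empirical_spectral_distribution A) f =
        (1 / real n) *\<^sub>R (\<Sum>i<n. f (real_eigenvalues A ! i))"
    unfolding empirical_spectral_distribution_def using A f m
    by (subst integral_distr)
      (auto simp: uniform_count_measure_def lebesgue_integral_point_measure_finite scaleR_sum_right)
  show "integrable (empirical_spectral_distribution A) f"
    unfolding empirical_spectral_distribution_def using f m
    by (subst integrable_distr_eq)
      (auto simp: uniform_count_measure_def integrable_point_measure_finite)
qed

lemma moment_empirical_spectral_distribution:
  assumes A: "A \<in> carrier_mat n n" "transpose_mat A = A"
  shows "(\<integral>x. x ^ k \<partial>empirical_spectral_distribution A) = mat_trace (A ^\<^sub>m k) / real n"
  using symmetric_real_eigenvalues[OF A]
  by (subst integral_empirical_spectral_distribution[OF A(1)])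
    (auto simp: sum_list_sum_nth atLeast0LessThan)

section \<open>Traces of powers as sums over closed walks\<close>

fun walk_weight :: "'a :: comm_monoid_mult mat \<Rightarrow> nat list \<Rightarrow> 'a" where
  "walk_weight A (y # x # ws) = A $$ (x, y) * walk_weight A (x # ws)"
| "walk_weight A _ = 1"

lemma pow_mat_eq_sum_walk_weight:
  fixes A :: "'a :: comm_semiring_1 mat"
  assumes A: "A \<in> carrier_mat n n" and "i < n" "j < n"
  shows "(A ^\<^sub>m k) $$ (i, j) =
    (\<Sum>ws | set ws \<subseteq> {..<n} \<and> length ws = Suc k \<and> last ws = i \<and> hd ws = j. walk_weight A ws)"
  using assms(2,3)
proof (induction k arbitrary: j)
  case 0
  have "{ws. set ws \<subseteq> {..<n} \<and> length ws = Suc 0 \<and> last ws = i \<and> hd ws = j} =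
    (if i = j then {[i]} else {})" using 0 by (auto simp: length_Suc_conv)
  then show ?case using A 0 by simp
next
  case (Suc k)
  define W where "W = (\<lambda>l. {ws. set ws \<subseteq> {..<n} \<and> length ws = Suc k \<and> last ws = i \<and> hd ws = l})"
  have fin: "finite (W l)" for l
    by (rule finite_subset[OF _ finite_lists_length_eq[of "{..<n}" "Suc k"]]) (auto simp: W_def)
  have "{ws. set ws \<subseteq> {..<n} \<and> length ws = Suc (Suc k) \<and> last ws = i \<and> hd ws = j} =
    (#) j ` (\<Union>l<n. W l)"
    using Suc.prems by (auto simp: length_Suc_conv W_def image_iff)
  then have "(\<Sum>ws | set ws \<subseteq> {..<n} \<and> length ws = Suc (Suc k) \<and> last ws = i \<and> hd ws = j. walk_weight A ws)
      = (\<Sum>ws\<in>(#) j ` (\<Union>l<n. W l). walk_weight A ws)" by simp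
  also have "\<dots> = (\<Sum>ws\<in>(\<Union>l<n. W l). walk_weight A (j # ws))"
    by (subst sum.reindex) (auto simp: o_def)
  also have "\<dots> = (\<Sum>l<n. \<Sum>ws\<in>W l. walk_weight A (j # ws))"
    using fin by (intro sum.UNION_disjoint) (auto simp: W_def)
  also have "\<dots> = (\<Sum>l<n. \<Sum>ws\<in>W l. walk_weight A ws * A $$ (l, j))"
    by (intro sum.cong refl) (auto simp: W_def length_Suc_conv mult.commute)
  also have "\<dots> = (\<Sum>l<n. (A ^\<^sub>m k) $$ (i, l) * A $$ (l, j))"
    using Suc unfolding W_def by (simp add: sum_distrib_right)
  also have "\<dots> = (A ^\<^sub>m Suc k) $$ (i, j)"
    using A Suc.prems by (simp add: scalar_prod_def atLeast0LessThan)
  finally show ?case ..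
qed

lemma mat_trace_pow_mat:
  fixes A :: "'a :: comm_semiring_1 mat"
  assumes A: "A \<in> carrier_mat n n"
  shows "mat_trace (A ^\<^sub>m k) =
    (\<Sum>ws | set ws \<subseteq> {..<n} \<and> length ws = Suc k \<and> hd ws = last ws. walk_weight A ws)"
proof -
  define W where "W = (\<lambda>i. {ws. set ws \<subseteq> {..<n} \<and> length ws = Suc k \<and> last ws = i \<and> hd ws = i})"
  have fin: "finite (W l)" for l
    by (rule finite_subset[OF _ finite_lists_length_eq[of "{..<n}" "Suc k"]]) (auto simp: W_def)
  have "{ws. set ws \<subseteq> {..<n} \<and> length ws = Suc k \<and> hd ws = last ws} = (\<Union>i<n. W i)"
    by (force simp: W_def length_Suc_conv)
  moreover have "(\<Sum>ws\<in>(\<Union>l<n. W l). walk_weight A ws) = (\<Sum>l<n. \<Sum>ws\<in>W l. walk_weight A ws)"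
    using fin by (intro sum.UNION_disjoint) (auto simp: W_def)
  moreover have "mat_trace (A ^\<^sub>m k) = (\<Sum>l<n. \<Sum>ws\<in>W l. walk_weight A ws)"
    using A pow_mat_eq_sum_walk_weight[OF A] by (simp add: mat_trace_def W_def)
  ultimately show ?thesis by simp
qed

lemma walk_weight_smult:
  fixes A :: "'a :: comm_ring_1 mat"
  assumes "A \<in> carrier_mat n n" "set ws \<subseteq> {..<n}"
  shows "walk_weight (c \<cdot>\<^sub>m A) ws = c ^ (length ws - 1) * walk_weight A ws"
  using assms
proof (induction A ws rule: walk_weight.induct)
  case (1 A y x ws)
  then show ?case by (simp add: mult_ac)
qed auto

subsection \<open>Moments of the semicircle distribution\<close>

text \<open>Under \<open>x = 2 cos \<theta>\<close> this is the orthogonality of the Chebyshev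
  polynomials of the second kind to the constant one. It is the base case of the moment recursion;
  \<open>h = 0\<close> is separate because the general antiderivative divides by
  \<open>h\<close>.\<close>

lemma has_integral_sin_mult_sin:
  "((\<lambda>x. sin (real (Suc h) * x) * sin x) has_integral (if h = 0 then pi / 2 else 0)) {0..pi}"
proof (cases "h = 0")
  case True
  have "((\<lambda>x. sin x * sin x) has_integral 1 / 2 * (pi - sin pi * cos pi) - 1 / 2 * (0 - sin 0 * cos 0)) {0..pi}"
  proof (rule fundamental_theorem_of_calculus)
    fix x :: real
    have sin_eq: "1 - cos x * cos x = sin x * sin x"
      using sin_cos_squared_add3[of x] by linarith
    have "((\<lambda>x. 1 / 2 * (x - sin x * cos x)) has_real_derivative
        1 / 2 * (1 - (cos x * cos x - sin x * sin x))) (at x within {0..pi})"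
    proof (rule DERIV_cmult)
      show "((\<lambda>x. x - sin x * cos x) has_real_derivative 1 - (cos x * cos x - sin x * sin x))
          (at x within {0..pi})"
        by (auto intro!: derivative_eq_intros simp: algebra_simps sin_eq)
    qed
    moreover have "1 / 2 * (1 - (cos x * cos x - sin x * sin x)) = sin x * sin x"
      using sin_eq by simp
    ultimately show "((\<lambda>x. 1 / 2 * (x - sin x * cos x)) has_vector_derivative sin x * sin x)
        (at x within {0..pi})"
      by (simp only: has_real_derivative_iff_has_vector_derivative)
  qed simp
  then show ?thesis using True by simp
next
  case False
  define F where "F = (\<lambda>x. (sin (real h * x) / real h - sin (real (h + 2) * x) / real (h + 2)) / 2)"
  have "((\<lambda>x. sin (real (Suc h) * x) * sin x) has_integral F pi - F 0) {0..pi}"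
  proof (rule fundamental_theorem_of_calculus)
    fix x :: real
    have "sin (real (Suc h) * x) * sin x = (cos (real h * x) - cos (real (h + 2) * x)) / 2"
      unfolding sin_times_sin by (simp add: algebra_simps)
    moreover have "(F has_real_derivative (cos (real h * x) - cos (real (h + 2) * x)) / 2) (at x within {0..pi})"
      unfolding F_def using False
      by (auto intro!: derivative_eq_intros simp del: of_nat_add)
    ultimately show "(F has_vector_derivative sin (real (Suc h) * x) * sin x) (at x within {0..pi})"
      by (simp only: has_real_derivative_iff_has_vector_derivative)
  qed simp
  moreover have "F pi = 0" unfolding F_def by (simp only: sin_npi) simp
  moreover have "F 0 = 0" unfolding F_def by simp
  ultimately show ?thesis using False by simp
qed

text \<open>The identity \<open>2 cos x sin ((h + 1) x) = sin ((h + 2) x) + sin (h x)\<close> is the recursion of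
  \<^const>\<open>ballot_paths\<close>.\<close>

lemma has_integral_cos_power_ballot_paths:
  "((\<lambda>x. (2 * cos x) ^ t * (sin (real (Suc h) * x) * sin x)) has_integral
     pi / 2 * real (ballot_paths t h)) {0..pi}"
proof (induction t arbitrary: h)
  case 0
  then show ?case using has_integral_sin_mult_sin[of h] by (simp split: if_splits)
next
  case (Suc t)
  have eq: "2 * cos x * sin (real (Suc h) * x) = sin (real h * x) + sin (real (Suc (Suc h)) * x)" for x
    using sin_add[of "real (Suc h) * x" x] sin_diff[of "real (Suc h) * x" x]
    by (simp add: algebra_simps)
  have *: "(2 * cos x) ^ Suc t * (sin (real (Suc h) * x) * sin x) =
    (2 * cos x) ^ t * (sin (real h * x) * sin x) +
    (2 * cos x) ^ t * (sin (real (Suc (Suc h)) * x) * sin x)" for x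
  proof -
    have "(2 * cos x) ^ Suc t * (sin (real (Suc h) * x) * sin x) =
      (2 * cos x) ^ t * (2 * cos x * sin (real (Suc h) * x)) * sin x"
      by (simp only: power_Suc mult_ac)
    then show ?thesis unfolding eq by (simp only: ring_distribs mult.assoc)
  qed
  have "((\<lambda>x. (2 * cos x) ^ t * (sin (real h * x) * sin x)) has_integral
    pi / 2 * real (if h = 0 then 0 else ballot_paths t (h - 1))) {0..pi}"
    using Suc[of "h - 1"] by (cases h) auto
  from has_integral_add[OF this Suc[of "Suc h"]] show ?case
    unfolding * by (simp add: ring_distribs)
qed

lemma has_integral_semicircle_power:
  "((\<lambda>x. 1 / (2 * pi) * sqrt (4 - x\<^sup>2) * x ^ k) has_integral real (ballot_paths k 0)) {-2..2}"
proof -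
  define f where "f = (\<lambda>x. 1 / (2 * pi) * sqrt (4 - x\<^sup>2) * x ^ k)"
  have cont: "continuous_on {-2..2} f" unfolding f_def by (intro continuous_intros)
  have cr: "(\<lambda>x. 2 * cos x) ` {0..pi} \<subseteq> {-2..2}" 
    using cos_le_one cos_ge_minus_one by auto
  \<comment> \<open>As \<open>2 cos x\<close> decreases from 2 to -2, the first of the two integrals
    is over an empty interval and the second one carries the sign.\<close>
  have "((\<lambda>x. (- 2 * sin x) *\<^sub>R f (2 * cos x)) has_integral
      (integral {2 * cos 0..2 * cos pi} f - integral {2 * cos pi..2 * cos 0} f)) {0..pi}"
    by (rule has_integral_substitution_general[of "{}" 0 pi _ "-2" 2])
      (use cont cr in \<open>auto intro!: continuous_intros derivative_eq_intros\<close>)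
  then have "((\<lambda>x. (- 2 * sin x) * f (2 * cos x)) has_integral - integral {-2..2} f) {0..pi}"
    by simp
  from has_integral_neg[OF this]
  have "((\<lambda>x. 2 * sin x * f (2 * cos x)) has_integral integral {-2..2} f) {0..pi}" by simp
  moreover have "((\<lambda>x. 2 * sin x * f (2 * cos x)) has_integral 2 / pi * (pi / 2 * real (ballot_paths k 0))) {0..pi}"
  proof (rule has_integral_eq[OF _ has_integral_mult_right[OF has_integral_cos_power_ballot_paths[of k 0]]])
    fix x assume x: "x \<in> {0..pi}"
    have "4 - (2 * cos x)\<^sup>2 = (2 * sin x)\<^sup>2" by (simp add: power_mult_distrib sin_squared_eq)
    then have "sqrt (4 - (2 * cos x)\<^sup>2) = 2 * sin x" using x sin_ge_zero[of x] by (simp only: real_sqrt_abs) simp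
    then show "2 / pi * ((2 * cos x) ^ k * (sin (real (Suc 0) * x) * sin x)) = 2 * sin x * f (2 * cos x)"
      unfolding f_def by (simp add: field_simps)
  qed
  ultimately have "integral {-2..2} f = real (ballot_paths k 0)"
    by (simp add: has_integral_unique)
  moreover have "f integrable_on {-2..2}" using cont by (rule integrable_continuous_real)
  ultimately show ?thesis unfolding f_def using integrable_integral by fastforce
qed

text \<open>The indicator matters: \<open>sqrt\<close> of a negative number is negative here, not
  0.\<close>

lemma semicircle_density_nonneg:
  "0 \<le> 1 / (2 * pi) * sqrt (4 - x\<^sup>2) * indicator {x. \<bar>x\<bar> \<le> 2} x"
proof (cases "\<bar>x\<bar> \<le> 2")
  case True
  then have "x\<^sup>2 \<le> 4" using abs_le_square_iff[of x 2] by simp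
  then show ?thesis by simp
qed simp

lemma
  shows integrable_semicircle_power: "integrable semicircle_distribution (\<lambda>x. x ^ k)"
    and moment_semicircle: "(\<integral>x. x ^ k \<partial>semicircle_distribution) = real (ballot_paths k 0)"
proof -
  let ?d = "\<lambda>x::real. 1 / (2 * pi) * sqrt (4 - x\<^sup>2) * indicator {x. \<bar>x\<bar> \<le> 2} x"
  have set: "{x. \<bar>x\<bar> \<le> (2::real)} = {-2..2}" by auto
  have s: "set_integrable lborel {-2..2} (\<lambda>x. 1 / (2 * pi) * sqrt (4 - x\<^sup>2) * x ^ k)"
    by (rule borel_integrable_atLeastAtMost') (intro continuous_intros)
  from s have si: "integrable lborel (\<lambda>x. indicator {-2..2} x * (1 / (2 * pi) * sqrt (4 - x\<^sup>2) * x ^ k))"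
    unfolding set_integrable_def by simp
  have li: "(\<integral>x. indicator {-2..2} x * (1 / (2 * pi) * sqrt (4 - x\<^sup>2) * x ^ k) \<partial>lborel) =
      real (ballot_paths k 0)"
    using set_borel_integral_eq_integral(2)[OF s]
      integral_unique[OF has_integral_semicircle_power[of k]]
    by (simp only: set_lebesgue_integral_def real_scaleR_def)
  have eq: "?d x * x ^ k = indicator {-2..2} x * (1 / (2 * pi) * sqrt (4 - x\<^sup>2) * x ^ k)" for x
    unfolding set by simp
  have nn: "AE x in lborel. 0 \<le> ?d x" using semicircle_density_nonneg by (intro always_eventually allI)
  have meas: "?d \<in> borel_measurable lborel" "(\<lambda>x::real. x ^ k) \<in> borel_measurable lborel" by measurable
  show "integrable semicircle_distribution (\<lambda>x. x ^ k)"
    unfolding semicircle_distribution_def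
    by (subst integrable_density[OF meas(2,1) nn]) (use si in \<open>simp only: real_scaleR_def eq\<close>)
  show "(\<integral>x. x ^ k \<partial>semicircle_distribution) = real (ballot_paths k 0)"
    unfolding semicircle_distribution_def
    by (subst integral_density[OF meas(2,1) nn]) (use li in \<open>simp only: real_scaleR_def eq\<close>)
qed

lemma real_distribution_semicircle: "real_distribution semicircle_distribution"
proof -
  have m: "measure semicircle_distribution (space semicircle_distribution) = 1"
    using moment_semicircle[of 0] by simp
  \<comment> \<open>An infinite mass would have \<open>measure\<close> 0, so the value 1 of the
    zeroth moment is genuine.\<close>
  then have "emeasure semicircle_distribution (space semicircle_distribution) \<noteq> \<infinity>"
    by (auto simp: measure_def)
  with m have "emeasure semicircle_distribution (space semicircle_distribution) = 1"
    by (simp add: emeasure_eq_ennreal_measure)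
  then interpret prob_space semicircle_distribution by (rule prob_spaceI)
  show ?thesis
    by unfold_locales (auto simp: semicircle_distribution_def)
qed

text \<open>This exponential bound on the semicircle moments is enough, since the Taylor remainder
  divides them by a factorial.\<close>

lemma ballot_paths_le: "ballot_paths t h \<le> 2 ^ t"
proof (induction t arbitrary: h)
  case (Suc t)
  show ?case using Suc[of "h - 1"] Suc[of "Suc h"] by (cases h) simp_all
qed simp

subsection \<open>Asymptotics of the closed walk sums\<close>

text \<open>The root ranges over all of \<open>V\<close>, as in a trace. \<open>distinct_adj\<close>
  discards walks that use a diagonal entry, whose weight is zero for an adjacency matrix.\<close>

definition closed_walks :: "'a set \<Rightarrow> nat \<Rightarrow> 'a list set" where
  "closed_walks V k =
     {ws. set ws \<subseteq> V \<and> length ws = Suc k \<and> hd ws = last ws \<and> distinct_adj ws}"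

lemma finite_closed_walks: "finite V \<Longrightarrow> finite (closed_walks V k)"
  by (rule finite_subset[OF _ finite_lists_length_eq[of V "Suc k"]]) (auto simp: closed_walks_def)

lemma contours_subset_closed_walks: "contours V k 0 \<subseteq> closed_walks V k"
proof
  fix ws assume ws: "ws \<in> contours V k 0"
  then have "ws \<noteq> []" by (auto simp: contours_def)
  with ws have "hd ws = last ws"
    using depth_eq_0_iff[of "hd ws" ws] by (auto simp: contours_def)
  with ws show "ws \<in> closed_walks V k"
    using contourD(1) by (auto simp: contours_def closed_walks_def)
qed

text \<open>First the set of \<open>v\<close> values is chosen, in at most \<open>card V ^ v\<close>
  ways, and then a word over it.\<close>

lemma card_lists_card_set_le:
  assumes "finite V"
  shows "card {ws. set ws \<subseteq> V \<and> length ws = m \<and> card (set ws) = v} \<le> card V ^ v * v ^ m"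
proof -
  let ?S = "{S. S \<subseteq> V \<and> card S = v}"
  have fin: "finite S" if "S \<in> ?S" for S using that assms finite_subset by blast
  have fS: "finite ?S" using assms by simp
  have "card {ws. set ws \<subseteq> V \<and> length ws = m \<and> card (set ws) = v}
      \<le> card (\<Union>S\<in>?S. {ws. set ws \<subseteq> S \<and> length ws = m})"
    using fS fin finite_lists_length_eq by (intro card_mono finite_UN_I) blast+
  also have "\<dots> \<le> (\<Sum>S\<in>?S. card {ws. set ws \<subseteq> S \<and> length ws = m})"
    by (rule card_UN_le[OF fS])
  also have "\<dots> = (\<Sum>S\<in>?S. v ^ m)"
    using fin by (intro sum.cong refl) (simp add: card_lists_length_eq)
  also have "\<dots> = (card V choose v) * v ^ m"
    using n_subsets[OF assms, of v] by simp
  also have "\<dots> \<le> card V ^ v * v ^ m"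
    by (cases "v \<le> card V") (auto intro: mult_right_mono binomial_le_pow simp: binomial_eq_0)
  finally show ?thesis .
qed

text \<open>Grouped by the number of vertices, the weight cancels the power of \<open>card V\<close>
  in the count. The bound is thus uniform in the size of \<open>V\<close>.\<close>

lemma sum_inverse_power_card_set_le:
  assumes "finite V" "0 < card V"
  shows "(\<Sum>ws | set ws \<subseteq> V \<and> length ws = m. 1 / real (card V) ^ card (set ws)) \<le> real (Suc m * m ^ m)"
proof -
  let ?L = "{ws. set ws \<subseteq> V \<and> length ws = m}"
  let ?g = "\<lambda>v. {ws. set ws \<subseteq> V \<and> length ws = m \<and> card (set ws) = v}"
  have "(\<Sum>ws\<in>?L. 1 / real (card V) ^ card (set ws)) =
      (\<Sum>v\<le>m. \<Sum>ws\<in>{ws \<in> ?L. card (set ws) = v}. 1 / real (card V) ^ card (set ws))"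
    by (rule sum.group[symmetric])
      (use assms finite_lists_length_eq[of V m] card_length in auto)
  also have "\<dots> = (\<Sum>v\<le>m. real (card (?g v)) * (1 / real (card V) ^ v))"
    by (intro sum.cong refl) (auto simp: conj_ac intro!: sum.cong)
  also have "\<dots> \<le> (\<Sum>v\<le>m. real (card V ^ v * v ^ m) * (1 / real (card V) ^ v))"
    by (intro sum_mono mult_right_mono of_nat_mono card_lists_card_set_le[OF assms(1)]) simp
  also have "\<dots> = (\<Sum>v\<le>m. real (v ^ m))"
    using assms by (auto simp: card_gt_0_iff intro!: sum.cong)
  also have "\<dots> \<le> (\<Sum>v\<le>m. real (m ^ m))"
    by (intro sum_mono of_nat_mono power_mono) auto
  also have "\<dots> = real (Suc m * m ^ m)" by (simp only: sum_constant card_atMost of_nat_mult)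
  finally show ?thesis .
qed

text \<open>A closed walk that is no contour walk either has a cycle, which costs a factor \<open>1 / n\<close>, or is a
  tree walk with fewer than \<open>k / 2\<close> edges, which costs a factor \<open>1 / \<surd>l\<close>.\<close>

lemma closed_walk_weight_le:
  fixes l :: real
  assumes ws: "ws \<in> closed_walks V k - contours V k 0" and n: "real n \<ge> l" "l \<ge> 1"
  shows "(1 / real n) * (1 / sqrt l) ^ k * (l / real n) ^ card (walk_edges ws)
    \<le> (l ^ Suc k / real n + 1 / sqrt l) * (1 / real n ^ card (set ws))"
proof -
  define e v where "e = card (walk_edges ws)" and "v = card (set ws)"
  have len: "length ws = Suc k" "ws \<noteq> []" and cl: "hd ws = last ws"
    using ws by (auto simp: closed_walks_def)
  have n0: "real n > 0" using n by simp
  have sq: "sqrt l \<ge> 1" using n by simp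
  have "v \<le> Suc k" unfolding v_def using len card_length[of ws] by simp
  show ?thesis
  proof (cases "v \<le> e")
    case True
    have "(1 / sqrt l) ^ k \<le> 1" using sq by (intro power_le_one) auto
    \<comment> \<open>As \<open>l / n\<close> is at most 1, the exponent may be lowered to
      \<open>v\<close>; the prefactor \<open>1 / n\<close> is then the gain.\<close>
    moreover have "(l / real n) ^ e \<le> l ^ Suc k * (1 / real n ^ v)"
    proof (rule order.trans)
      show "(l / real n) ^ e \<le> (l / real n) ^ v"
        using n True by (intro power_decreasing) auto
      have "l ^ v \<le> l ^ Suc k" using n \<open>v \<le> Suc k\<close> by (intro power_increasing) auto
      from divide_right_mono[OF this, of "real n ^ v"]
      show "(l / real n) ^ v \<le> l ^ Suc k * (1 / real n ^ v)" by (simp add: power_divide)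
    qed
    ultimately have "(1 / sqrt l) ^ k * (l / real n) ^ e \<le> 1 * (l ^ Suc k * (1 / real n ^ v))"
      using n by (intro mult_mono) auto
    from mult_left_mono[OF this, of "1 / real n"]
    have "(1 / real n) * (1 / sqrt l) ^ k * (l / real n) ^ e \<le> (l ^ Suc k / real n) * (1 / real n ^ v)"
      by (simp add: mult.assoc)
    also have "\<dots> \<le> (l ^ Suc k / real n + 1 / sqrt l) * (1 / real n ^ v)"
      using n by (intro mult_right_mono) auto
    finally show ?thesis unfolding e_def v_def .
  next
    case False
    then have v: "v = Suc e"
      using card_set_le_Suc_card_walk_edges[of ws] unfolding e_def v_def by simp
    have "depth ws (hd ws) = 0" using depth_eq_0_iff[of "hd ws" ws] cl len by simp
    then have "\<not> contour ws" using ws by (auto simp: contours_def closed_walks_def)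
    \<comment> \<open>At depth 0 the bound reads \<open>2 * e <= k\<close>, with equality only for
      contour walks.\<close>
    with tree_walk_card_edges_le[of ws] v len \<open>depth ws (hd ws) = 0\<close>
    have "2 * e < k" unfolding e_def v_def by linarith
    have "l ^ e = sqrt l ^ (2 * e)" using n by (simp add: power_mult)
    then have "(1 / sqrt l) ^ k * l ^ e = (1 / sqrt l) ^ (k - 2 * e)"
      using \<open>2 * e < k\<close> sq by (simp add: power_one_over power_diff)
    also have "\<dots> \<le> (1 / sqrt l) ^ 1"
      using \<open>2 * e < k\<close> sq by (intro power_decreasing) auto
    finally have "(1 / sqrt l) ^ k * l ^ e \<le> 1 / sqrt l" by simp
    from mult_right_mono[OF this, of "1 / real n ^ v"]
    have "(1 / sqrt l) ^ k * l ^ e * (1 / real n ^ v) \<le> 1 / sqrt l * (1 / real n ^ v)" by simp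
    also have "(1 / sqrt l) ^ k * l ^ e * (1 / real n ^ v) =
        (1 / real n) * (1 / sqrt l) ^ k * (l / real n) ^ e"
      unfolding v by (simp add: power_divide mult_ac)
    also have "1 / sqrt l * (1 / real n ^ v) \<le> (l ^ Suc k / real n + 1 / sqrt l) * (1 / real n ^ v)"
      using n by (intro mult_right_mono) auto
    finally show ?thesis unfolding e_def v_def .
  qed
qed

text \<open>The \<open>k\<close>-th moment of the expected empirical spectral distribution of \<open>M\<^bsub>n,l/n\<^esub> / \<surd>l\<close>.\<close>
definition expected_moment :: "nat \<Rightarrow> nat \<Rightarrow> real \<Rightarrow> real" where
  "expected_moment k n l =
     (1 / real n) * (1 / sqrt l) ^ k * (\<Sum>ws\<in>closed_walks {..<n} k. (l / real n) ^ card (walk_edges ws))"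

text \<open>For \<open>k = 2 * j\<close> each contour walk has \<open>j\<close> edges, so
  \<open>l\<close> cancels exactly and the weight is \<open>1 / n ^ (j + 1)\<close>, one
  \<open>1 / n\<close> for each factor of the falling product. For odd \<open>k\<close> both sides
  are 0.\<close>

lemma contours_weight:
  fixes l :: real
  assumes "0 < n" "l > 0"
  shows "(\<Sum>ws\<in>contours {..<n} k 0. (1 / real n) * (1 / sqrt l) ^ k * (l / real n) ^ card (walk_edges ws))
    = real (ballot_paths k 0) * (\<Prod>i<Suc (k div 2). 1 - real i / real n)"
proof (cases "even k")
  case False
  then have "ballot_paths k 0 = 0" by (intro ballot_paths_odd) simp
  moreover from this card_contours[of "{..<n}" k 0] have "contours {..<n} k 0 = {}"
    using finite_contours[of "{..<n}" k 0] by simp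
  ultimately show ?thesis by simp
next
  case True
  then obtain j where k: "k = 2 * j" by (rule evenE)
  have "card (walk_edges ws) = j" if "ws \<in> contours {..<n} k 0" for ws
    using that contourD(3)[of ws] k by (auto simp: contours_def)
  then have "(\<Sum>ws\<in>contours {..<n} k 0. (1 / real n) * (1 / sqrt l) ^ k * (l / real n) ^ card (walk_edges ws))
      = real (card (contours {..<n} k 0)) * ((1 / real n) * (1 / sqrt l) ^ k * (l / real n) ^ j)"
    by simp
  also have "(1 / real n) * (1 / sqrt l) ^ k * (l / real n) ^ j = 1 / real n ^ Suc j"
    using assms by (simp add: k power_mult power_divide)
  also have "real (card (contours {..<n} k 0)) * (1 / real n ^ Suc j) =
      real (ballot_paths k 0) * ((\<Prod>i<Suc j. real n - real i) / (\<Prod>i<Suc j. real n))"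
    by (simp add: card_contours k)
  also have "(\<Prod>i<Suc j. real n - real i) / (\<Prod>i<Suc j. real n) = (\<Prod>i<Suc j. 1 - real i / real n)"
    unfolding prod_dividef[symmetric] using assms by (intro prod.cong refl) (simp add: diff_divide_distrib)
  finally show ?thesis by (simp add: k)
qed

lemma expected_moment_estimate:
  fixes l :: real
  assumes "real n \<ge> l" "l \<ge> 1"
  shows "\<bar>expected_moment k n l - real (ballot_paths k 0) * (\<Prod>i<Suc (k div 2). 1 - real i / real n)\<bar>
    \<le> (l ^ Suc k / real n + 1 / sqrt l) * real (Suc (Suc k) * Suc k ^ Suc k)"
proof -
  let ?w = "\<lambda>ws. (1 / real n) * (1 / sqrt l) ^ k * (l / real n) ^ card (walk_edges ws)"
  let ?C = "closed_walks {..<n} k" and ?D = "contours {..<n} k 0"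
  let ?r = "l ^ Suc k / real n + 1 / sqrt l"
  have fin: "finite ?C" by (simp add: finite_closed_walks)
  have n: "0 < n" using assms by (cases n) auto
  have r: "0 \<le> ?r" using assms by simp
  have "expected_moment k n l = (\<Sum>ws\<in>?C. ?w ws)"
    unfolding expected_moment_def by (simp add: sum_distrib_left)
  also have "\<dots> = (\<Sum>ws\<in>?C - ?D. ?w ws) + (\<Sum>ws\<in>?D. ?w ws)"
    by (rule sum.subset_diff[OF contours_subset_closed_walks fin])
  also have "(\<Sum>ws\<in>?D. ?w ws) = real (ballot_paths k 0) * (\<Prod>i<Suc (k div 2). 1 - real i / real n)"
    using n assms by (intro contours_weight) auto
  finally have "expected_moment k n l - real (ballot_paths k 0) * (\<Prod>i<Suc (k div 2). 1 - real i / real n)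
      = (\<Sum>ws\<in>?C - ?D. ?w ws)" by simp
  moreover have "(\<Sum>ws\<in>?C - ?D. ?w ws) \<ge> 0"
    using assms by (intro sum_nonneg) auto
  moreover have "(\<Sum>ws\<in>?C - ?D. ?w ws) \<le> (\<Sum>ws\<in>?C - ?D. ?r * (1 / real n ^ card (set ws)))"
    using assms by (intro sum_mono closed_walk_weight_le) auto
  \<comment> \<open>Enlarging the index set to all words makes the uniform bound on the sum
    applicable.\<close>
  moreover have "\<dots> \<le> (\<Sum>ws | set ws \<subseteq> {..<n} \<and> length ws = Suc k. ?r * (1 / real n ^ card (set ws)))"
    using r finite_lists_length_eq[of "{..<n}" "Suc k"]
    by (intro sum_mono2) (auto simp: closed_walks_def)
  moreover have "\<dots> = ?r * (\<Sum>ws | set ws \<subseteq> {..<n} \<and> length ws = Suc k. 1 / real n ^ card (set ws))"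
    by (simp only: sum_distrib_left)
  moreover have "\<dots> \<le> ?r * real (Suc (Suc k) * Suc k ^ Suc k)"
    using sum_inverse_power_card_set_le[of "{..<n}" "Suc k"] n by (intro mult_left_mono r) auto
  ultimately show ?thesis by linarith
qed

text \<open>For fixed \<open>l\<close> the estimate leaves an error \<open>?C / sqrt l\<close> that
  does not vanish with \<open>n\<close>. The other errors tend to 0 and eventually fit into a second
  \<open>?C / sqrt l\<close>, whence the factor 2.\<close>

lemma eventually_expected_moment:
  fixes l :: real
  assumes "l \<ge> 1"
  shows "\<forall>\<^sub>F n in sequentially. \<bar>expected_moment k n l - real (ballot_paths k 0)\<bar>
    \<le> 2 * real (Suc (Suc k) * Suc k ^ Suc k) / sqrt l"
proof -
  let ?C = "real (Suc (Suc k) * Suc k ^ Suc k)" and ?b = "real (ballot_paths k 0)"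
  let ?P = "\<lambda>n. \<Prod>i<Suc (k div 2). 1 - real i / real n"
  have "(\<lambda>n. ?b * ?P n - ?b + l ^ Suc k / real n * ?C) \<longlonglongrightarrow> ?b * (\<Prod>i<Suc (k div 2). 1 - 0) - ?b + 0 * ?C"
    by (intro tendsto_intros lim_const_over_n)
  moreover have "(\<lambda>n. ?b - ?b * ?P n + l ^ Suc k / real n * ?C) \<longlonglongrightarrow> ?b - ?b * (\<Prod>i<Suc (k div 2). 1 - 0) + 0 * ?C"
    by (intro tendsto_intros lim_const_over_n)
  moreover have "0 < ?C" by (simp only: of_nat_0_less_iff) simp
  then have "0 < ?C / sqrt l" using assms by (intro divide_pos_pos) auto
  ultimately have "\<forall>\<^sub>F n in sequentially. ?b * ?P n - ?b + l ^ Suc k / real n * ?C < ?C / sqrt l"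
    "\<forall>\<^sub>F n in sequentially. ?b - ?b * ?P n + l ^ Suc k / real n * ?C < ?C / sqrt l"
    by (auto dest!: order_tendstoD(2)[where a = "?C / sqrt l"]
        simp del: of_nat_mult of_nat_Suc mult_Suc power_Suc)
  moreover have "\<forall>\<^sub>F n in sequentially. real n \<ge> l"
    using filterlim_real_sequentially by (simp add: filterlim_at_top)
  ultimately show ?thesis
  proof eventually_elim
    case (elim n)
    have "(l ^ Suc k / real n + 1 / sqrt l) * ?C = l ^ Suc k / real n * ?C + ?C / sqrt l"
      by (simp only: ring_distribs times_divide_eq_left mult_1_left)
    with expected_moment_estimate[OF elim(3) assms, of k] elim(1,2)
    show ?case by (simp only: times_divide_eq_right[symmetric])
  qed
qed

subsection \<open>Expectations over the random graph\<close>

lemma erdos_renyi_adjacency_symmetric: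
  assumes "erdos_renyi_adjacency \<Omega> n p M" "\<omega> \<in> space \<Omega>"
  shows "M \<omega> \<in> carrier_mat n n" "transpose_mat (M \<omega>) = M \<omega>"
    and "\<And>i. i < n \<Longrightarrow> M \<omega> $$ (i, i) = 0"
    and "\<And>i j. i < n \<Longrightarrow> j < n \<Longrightarrow> M \<omega> $$ (i, j) = M \<omega> $$ (j, i)"
proof -
  show c: "M \<omega> \<in> carrier_mat n n" and t: "transpose_mat (M \<omega>) = M \<omega>"
    and "\<And>i. i < n \<Longrightarrow> M \<omega> $$ (i, i) = 0"
    using assms by (auto simp: erdos_renyi_adjacency_def)
  show "M \<omega> $$ (i, j) = M \<omega> $$ (j, i)" if "i < n" "j < n" for i j
    using c t that by (metis carrier_matD index_transpose_mat(1))
qed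

lemma erdos_renyi_entry_measurable:
  assumes M: "erdos_renyi_adjacency \<Omega> n p M" and \<Omega>: "prob_space \<Omega>" and ij: "i < n" "j < n"
  shows "(\<lambda>\<omega>. M \<omega> $$ (i, j)) \<in> borel_measurable \<Omega>"
proof -
  interpret prob_space \<Omega> by fact
  have low: "(\<lambda>\<omega>. M \<omega> $$ (i, j)) \<in> borel_measurable \<Omega>" if "j < i" "i < n" for i j
    using M that unfolding erdos_renyi_adjacency_def indep_vars_def by auto
  consider "j < i" | "i < j" | "i = j" by linarith
  then show ?thesis
  proof cases
    case 1
    then show ?thesis using low ij by simp
  next
    case 2
    then have "(\<lambda>\<omega>. M \<omega> $$ (j, i)) \<in> borel_measurable \<Omega>" using low ij by simp
    then show ?thesis
      by (rule measurable_cong[THEN iffD1, rotated])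
        (rule erdos_renyi_adjacency_symmetric(4)[OF M _ ij(2,1)])
  next
    case 3
    have "(\<lambda>\<omega>. 0 :: real) \<in> borel_measurable \<Omega>" by simp
    then show ?thesis
      by (rule measurable_cong[THEN iffD1, rotated])
        (use erdos_renyi_adjacency_symmetric(3)[OF M _ ij(1)] 3 in simp)
  qed
qed

text \<open>The probabilities of the values 1 and 0 add up to one, so other values of an entry below
  the diagonal are confined to a null set; symmetry and the zero diagonal give the rest.\<close>

lemma erdos_renyi_entry_AE:
  assumes M: "erdos_renyi_adjacency \<Omega> n p M" and \<Omega>: "prob_space \<Omega>"
  shows "AE \<omega> in \<Omega>. \<forall>i<n. \<forall>j<n. M \<omega> $$ (i, j) = 0 \<or> M \<omega> $$ (i, j) = 1"
proof -
  interpret prob_space \<Omega> by fact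
  have low: "AE \<omega> in \<Omega>. M \<omega> $$ (i, j) = 0 \<or> M \<omega> $$ (i, j) = 1" if ij: "j < i" "i < n" for i j
  proof -
    have [measurable]: "(\<lambda>\<omega>. M \<omega> $$ (i, j)) \<in> borel_measurable \<Omega>"
      using erdos_renyi_entry_measurable[OF M \<Omega>] ij by simp
    have "prob ({\<omega>\<in>space \<Omega>. M \<omega> $$ (i, j) = 1} \<union> {\<omega>\<in>space \<Omega>. M \<omega> $$ (i, j) = 0}) = p + (1 - p)"
      using M ij by (subst finite_measure_Union) (auto simp: erdos_renyi_adjacency_def)
    moreover have "{\<omega>\<in>space \<Omega>. M \<omega> $$ (i, j) = 1} \<union> {\<omega>\<in>space \<Omega>. M \<omega> $$ (i, j) = 0} =
        {\<omega>\<in>space \<Omega>. M \<omega> $$ (i, j) = 0 \<or> M \<omega> $$ (i, j) = 1}" by auto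
    ultimately have "prob {\<omega>\<in>space \<Omega>. M \<omega> $$ (i, j) = 0 \<or> M \<omega> $$ (i, j) = 1} = 1" by simp
    then show ?thesis by (subst (asm) prob_Collect_eq_1) auto
  qed
  have "AE \<omega> in \<Omega>. \<forall>i\<in>{..<n}. \<forall>j\<in>{..<i}. M \<omega> $$ (i, j) = 0 \<or> M \<omega> $$ (i, j) = 1"
    using low by (simp add: AE_finite_all)
  with AE_space show ?thesis
  proof eventually_elim
    case (elim \<omega>)
    show ?case
    proof (intro allI impI)
      fix i j assume ij: "i < n" "j < n"
      consider "j < i" | "i < j" | "i = j" by linarith
      then show "M \<omega> $$ (i, j) = 0 \<or> M \<omega> $$ (i, j) = 1"
      proof cases
        case 1
        then show ?thesis using elim(2) ij by simp
      next
        case 2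
        then have "M \<omega> $$ (j, i) = 0 \<or> M \<omega> $$ (j, i) = 1" using elim(2) ij by simp
        then show ?thesis using erdos_renyi_adjacency_symmetric(4)[OF M elim(1) ij] by simp
      next
        case 3
        then show ?thesis using erdos_renyi_adjacency_symmetric(3)[OF M elim(1) ij(1)] by simp
      qed
    qed
  qed
qed

text \<open>With entries 0 and 1, repeated passages along an edge count once. The pair
  \<open>(Max e, Min e)\<close> selects the strictly lower triangular entry of the edge, where
  independence is available.\<close>

lemma walk_weight_eq_if:
  fixes A :: "real mat"
  assumes "set ws \<subseteq> {..<n}" "distinct_adj ws"
    and sym: "\<And>i j. i < n \<Longrightarrow> j < n \<Longrightarrow> A $$ (i, j) = A $$ (j, i)"
    and A01: "\<And>i j. i < n \<Longrightarrow> j < n \<Longrightarrow> A $$ (i, j) = 0 \<or> A $$ (i, j) = 1"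
  shows "walk_weight A ws = (if \<forall>e\<in>walk_edges ws. A $$ (Max e, Min e) = 1 then 1 else 0)"
  using assms(1,2)
proof (induction ws rule: walk_edges.induct)
  case (1 y x ws)
  then have xy: "x < n" "y < n" "x \<noteq> y"
    and IH: "walk_weight A (x # ws) = (if \<forall>e\<in>walk_edges (x # ws). A $$ (Max e, Min e) = 1 then 1 else 0)"
    by auto
  have "A $$ (Max {x, y}, Min {x, y}) = A $$ (x, y)"
    using sym xy by (auto simp: max_def min_def)
  then show ?case using IH A01[OF xy(1,2)] by auto
qed auto

lemma walk_edges_doubleton:
  "distinct_adj ws \<Longrightarrow> e \<in> walk_edges ws \<Longrightarrow> \<exists>x y. e = {x, y} \<and> x \<noteq> y \<and> x \<in> set ws \<and> y \<in> set ws"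
  by (induction ws rule: walk_edges.induct) auto

lemma walk_weight_not_distinct_adj:
  fixes A :: "real mat"
  assumes "set ws \<subseteq> {..<n}" "\<not> distinct_adj ws" "\<And>i. i < n \<Longrightarrow> A $$ (i, i) = 0"
  shows "walk_weight A ws = 0"
  using assms by (induction ws rule: walk_edges.induct) auto

text \<open>Almost surely the weight is the indicator that all distinct edges of the walk are
  present, and by independence each contributes one factor \<open>p\<close>. A repeated adjacent
  vertex meets the zero diagonal.\<close>

lemma
  assumes M: "erdos_renyi_adjacency \<Omega> n p M" and \<Omega>: "prob_space \<Omega>"
    and ws: "set ws \<subseteq> {..<n}"
  shows integrable_walk_weight: "integrable \<Omega> (\<lambda>\<omega>. walk_weight (M \<omega>) ws)"
    and expectation_walk_weight: "(\<integral>\<omega>. walk_weight (M \<omega>) ws \<partial>\<Omega>) =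
      (if distinct_adj ws then p ^ card (walk_edges ws) else 0)"
proof -
  interpret prob_space \<Omega> by fact
  have meas: "(\<lambda>\<omega>. walk_weight (M \<omega>) ws) \<in> borel_measurable \<Omega>"
    using ws
  proof (induction ws rule: walk_edges.induct)
    case (1 y x ws)
    then show ?case using erdos_renyi_entry_measurable[OF M \<Omega>, of x y]
      by (auto intro!: borel_measurable_times)
  qed auto
  have "integrable \<Omega> (\<lambda>\<omega>. walk_weight (M \<omega>) ws) \<and> (\<integral>\<omega>. walk_weight (M \<omega>) ws \<partial>\<Omega>) =
      (if distinct_adj ws then p ^ card (walk_edges ws) else 0)"
  proof (cases "distinct_adj ws")
    case False
    have "AE \<omega> in \<Omega>. walk_weight (M \<omega>) ws = 0"
      using walk_weight_not_distinct_adj[OF ws False] erdos_renyi_adjacency_symmetric(3)[OF M]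
      by (intro AE_I2) blast
    from integrable_cong_AE[OF meas _ this] integral_cong_AE[OF meas _ this]
    show ?thesis using False by simp
  next
    case True
    define J where "J = (\<lambda>e. (Max e, Min e)) ` walk_edges ws"
    define E where "E = {\<omega>\<in>space \<Omega>. \<forall>e\<in>walk_edges ws. M \<omega> $$ (Max e, Min e) = 1}"
    have Jsub: "J \<subseteq> {(i, j). j < i \<and> i < n}"
      using walk_edges_doubleton[OF True] ws unfolding J_def by (fastforce simp: max_def min_def)
    have inj: "inj_on (\<lambda>e. (Max e, Min e)) (walk_edges ws)"
    proof (rule inj_onI)
      fix e e' assume "e \<in> walk_edges ws" "e' \<in> walk_edges ws" and eq: "(Max e, Min e) = (Max e', Min e')"
      then obtain x y x' y' where "e = {x, y}" "e' = {x', y'}" using walk_edges_doubleton[OF True] by metis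
      then show "e = e'" using eq by (auto simp: max_def min_def split: if_splits)
    qed
    have fJ: "finite J" unfolding J_def by simp
    have EJ: "E = {\<omega>\<in>space \<Omega>. \<forall>(i, j)\<in>J. M \<omega> $$ (i, j) = 1}" unfolding E_def J_def by auto
    have probE: "prob E = p ^ card (walk_edges ws)"
    \<comment> \<open>The product rule \<open>indep_varsD\<close> asks for a nonempty index set; a
      walk without edges is treated by hand.\<close>
    proof (cases "J = {}")
      case True
      then show ?thesis using prob_space unfolding E_def J_def by simp
    next
      case False
      have iv: "indep_vars (\<lambda>_. borel) (\<lambda>(i, j) \<omega>. M \<omega> $$ (i, j)) {(i, j). j < i \<and> i < n}"
        using M unfolding erdos_renyi_adjacency_def by simp
      have "E = (\<Inter>ij\<in>J. (case ij of (i, j) \<Rightarrow> \<lambda>\<omega>. M \<omega> $$ (i, j)) -` {1} \<inter> space \<Omega>)"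
        using False unfolding EJ by auto
      also have "prob \<dots> = (\<Prod>ij\<in>J. prob ((case ij of (i, j) \<Rightarrow> \<lambda>\<omega>. M \<omega> $$ (i, j)) -` {1} \<inter> space \<Omega>))"
        using indep_varsD[OF iv False fJ Jsub, of "\<lambda>_. {1}"] by simp
      also have "\<dots> = (\<Prod>ij\<in>J. p)"
      proof (rule prod.cong[OF refl])
        fix ij assume "ij \<in> J"
        with Jsub obtain i j where ij: "ij = (i, j)" "j < i" "i < n" by blast
        have "(\<lambda>\<omega>. M \<omega> $$ (i, j)) -` {1} \<inter> space \<Omega> = {\<omega>\<in>space \<Omega>. M \<omega> $$ (i, j) = 1}" by auto
        then show "prob ((case ij of (i, j) \<Rightarrow> \<lambda>\<omega>. M \<omega> $$ (i, j)) -` {1} \<inter> space \<Omega>) = p"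
          using M ij unfolding erdos_renyi_adjacency_def by simp
      qed
      also have "\<dots> = p ^ card (walk_edges ws)"
        unfolding J_def using inj by (simp add: card_image)
      finally show ?thesis .
    qed
    have Em: "E \<in> events"
    proof -
      have "{\<omega>\<in>space \<Omega>. M \<omega> $$ (i, j) = 1} \<in> events" if "(i, j) \<in> J" for i j
      proof -
        have [measurable]: "(\<lambda>\<omega>. M \<omega> $$ (i, j)) \<in> borel_measurable \<Omega>"
          using that Jsub by (intro erdos_renyi_entry_measurable[OF M \<Omega>]) auto
        show ?thesis by measurable
      qed
      then show ?thesis unfolding EJ using fJ by (intro sets.sets_Collect_finite_All) auto
    qed
    have ae: "AE \<omega> in \<Omega>. walk_weight (M \<omega>) ws = indicator E \<omega>"
      using erdos_renyi_entry_AE[OF M \<Omega>] AE_space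
    proof eventually_elim
      case (elim \<omega>)
      have "walk_weight (M \<omega>) ws =
          (if \<forall>e\<in>walk_edges ws. M \<omega> $$ (Max e, Min e) = 1 then 1 else 0)"
        using elim erdos_renyi_adjacency_symmetric(4)[OF M elim(2)]
        by (intro walk_weight_eq_if[OF ws True]) auto
      then show ?case using elim(2) by (simp add: E_def indicator_def)
    qed
    have im: "indicator E \<in> borel_measurable \<Omega>" using Em by simp
    have "integrable \<Omega> (indicator E :: _ \<Rightarrow> real)"
      using Em by (simp add: integrable_indicator_iff emeasure_finite less_top[symmetric])
    then have "integrable \<Omega> (\<lambda>\<omega>. walk_weight (M \<omega>) ws)"
      using integrable_cong_AE[OF meas im ae] by simp
    moreover have "(\<integral>\<omega>. walk_weight (M \<omega>) ws \<partial>\<Omega>) = prob E"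
      using integral_cong_AE[OF meas im ae] Em by simp
    ultimately show ?thesis using True probE by simp
  qed
  then show "integrable \<Omega> (\<lambda>\<omega>. walk_weight (M \<omega>) ws)"
    and "(\<integral>\<omega>. walk_weight (M \<omega>) ws \<partial>\<Omega>) = (if distinct_adj ws then p ^ card (walk_edges ws) else 0)"
    by auto
qed

lemma smult_mat_symmetric:
  assumes "A \<in> carrier_mat n n" "transpose_mat A = A"
  shows "c \<cdot>\<^sub>m A \<in> carrier_mat n n" "transpose_mat (c \<cdot>\<^sub>m A) = c \<cdot>\<^sub>m A"
  using assms by (auto intro!: eq_matI) (metis carrier_matD index_transpose_mat(1))

lemma mat_trace_smult_pow:
  fixes A :: "real mat"
  assumes A: "A \<in> carrier_mat n n"
  shows "mat_trace ((c \<cdot>\<^sub>m A) ^\<^sub>m k) =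
    c ^ k * (\<Sum>ws | set ws \<subseteq> {..<n} \<and> length ws = Suc k \<and> hd ws = last ws. walk_weight A ws)"
proof -
  have "c \<cdot>\<^sub>m A \<in> carrier_mat n n" using A by simp
  from mat_trace_pow_mat[OF this, of k] show ?thesis
    by (simp add: walk_weight_smult[OF A] sum_distrib_left)
qed

lemma
  assumes M: "erdos_renyi_adjacency \<Omega> n (l / real n) M" and \<Omega>: "prob_space \<Omega>"
  defines "X \<equiv> \<lambda>k \<omega>. \<integral>x. x ^ k \<partial>empirical_spectral_distribution ((1 / sqrt l) \<cdot>\<^sub>m M \<omega>)"
  shows integrable_empirical_moment: "integrable \<Omega> (X k)"
    and expectation_empirical_moment: "(\<integral>\<omega>. X k \<omega> \<partial>\<Omega>) = expected_moment k n l"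
proof -
  define Y where "Y = (\<lambda>\<omega>. (1 / real n) * (1 / sqrt l) ^ k *
    (\<Sum>ws | set ws \<subseteq> {..<n} \<and> length ws = Suc k \<and> hd ws = last ws. walk_weight (M \<omega>) ws))"
  have XY: "X k \<omega> = Y \<omega>" if "\<omega> \<in> space \<Omega>" for \<omega>
  proof -
    note A = erdos_renyi_adjacency_symmetric(1,2)[OF M that]
    show ?thesis
      unfolding X_def Y_def moment_empirical_spectral_distribution[OF smult_mat_symmetric[OF A]]
        mat_trace_smult_pow[OF A(1)] by simp
  qed
  have "integrable \<Omega> Y"
    unfolding Y_def using integrable_walk_weight[OF M \<Omega>] by (intro integrable_mult_right integrable_sum) auto
  then show "integrable \<Omega> (X k)"
    using XY by (subst Bochner_Integration.integrable_cong[OF refl, of _ _ Y]) auto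
  have fin: "finite {ws. set ws \<subseteq> {..<n} \<and> length ws = Suc k \<and> hd ws = last ws}"
    by (rule finite_subset[OF _ finite_lists_length_eq[of "{..<n}" "Suc k"]]) auto
  have "(\<integral>\<omega>. X k \<omega> \<partial>\<Omega>) = (\<integral>\<omega>. Y \<omega> \<partial>\<Omega>)" using XY by (rule Bochner_Integration.integral_cong[OF refl])
  also have "\<dots> = (1 / real n) * (1 / sqrt l) ^ k *
    (\<Sum>ws | set ws \<subseteq> {..<n} \<and> length ws = Suc k \<and> hd ws = last ws. \<integral>\<omega>. walk_weight (M \<omega>) ws \<partial>\<Omega>)"
    unfolding Y_def using integrable_walk_weight[OF M \<Omega>]
    by (subst integral_mult_right_zero, subst Bochner_Integration.integral_sum) auto
  also have "\<dots> = (1 / real n) * (1 / sqrt l) ^ k *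
    (\<Sum>ws | set ws \<subseteq> {..<n} \<and> length ws = Suc k \<and> hd ws = last ws.
      if distinct_adj ws then (l / real n) ^ card (walk_edges ws) else 0)"
    using expectation_walk_weight[OF M \<Omega>] by simp
  also have "\<dots> = expected_moment k n l"
    unfolding expected_moment_def closed_walks_def
    by (subst sum.inter_filter[OF fin, symmetric]) (auto intro!: arg_cong[where f = "sum _"] simp: conj_ac)
  finally show "(\<integral>\<omega>. X k \<omega> \<partial>\<Omega>) = expected_moment k n l" .
qed

subsection \<open>Characteristic functions\<close>

text \<open>The distribution has finitely many atoms, so the exponential series may be averaged
  termwise. This expresses the characteristic function through moments, whose measurability in the
  random matrix is known.\<close>

lemma char_empirical_spectral_distribution_sums:
  assumes A: "A \<in> carrier_mat n n"
  shows "(\<lambda>k. (\<i> * of_real t) ^ k / fact k *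
      complex_of_real (\<integral>x. x ^ k \<partial>empirical_spectral_distribution A))
    sums char (empirical_spectral_distribution A) t"
proof -
  let ?L = "\<lambda>i. real_eigenvalues A ! i"
  have "(\<lambda>k. (1 / real n) *\<^sub>R (\<Sum>i<n. (\<i> * of_real (t * ?L i)) ^ k /\<^sub>R fact k)) sums
    ((1 / real n) *\<^sub>R (\<Sum>i<n. exp (\<i> * of_real (t * ?L i))))"
    by (intro sums_scaleR_right sums_sum exp_converges)
  moreover have "char (empirical_spectral_distribution A) t =
      (1 / real n) *\<^sub>R (\<Sum>i<n. exp (\<i> * of_real (t * ?L i)))"
    unfolding char_def by (subst integral_empirical_spectral_distribution[OF A]) auto
  moreover have "(\<lambda>k. (1 / real n) *\<^sub>R (\<Sum>i<n. (\<i> * of_real (t * ?L i)) ^ k /\<^sub>R fact k)) =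
    (\<lambda>k. (\<i> * of_real t) ^ k / fact k * complex_of_real (\<integral>x. x ^ k \<partial>empirical_spectral_distribution A))"
  proof
    fix k
    have "(\<integral>x. x ^ k \<partial>empirical_spectral_distribution A) = (1 / real n) * (\<Sum>i<n. ?L i ^ k)"
      by (subst integral_empirical_spectral_distribution[OF A]) auto
    then show "(1 / real n) *\<^sub>R (\<Sum>i<n. (\<i> * of_real (t * ?L i)) ^ k /\<^sub>R fact k) =
      (\<i> * of_real t) ^ k / fact k * complex_of_real (\<integral>x. x ^ k \<partial>empirical_spectral_distribution A)"
      by (simp add: scaleR_conv_of_real power_mult_distrib sum_distrib_left divide_inverse mult_ac)
  qed
  ultimately show ?thesis by simp
qed

text \<open>Measurability comes from the moment series, without measurability of single eigenvalues.
  The Taylor remainder is bounded by an absolute moment, which for even \<open>K\<close> is the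
  ordinary moment and so has a known expectation.\<close>

lemma
  fixes t :: real
  assumes M: "erdos_renyi_adjacency \<Omega> n (l / real n) M" and \<Omega>: "prob_space \<Omega>" and n: "0 < n"
  defines "\<Psi> \<equiv> \<lambda>\<omega>. char (empirical_spectral_distribution ((1 / sqrt l) \<cdot>\<^sub>m M \<omega>)) t"
  shows measurable_empirical_char: "\<Psi> \<in> borel_measurable \<Omega>"
    and expectation_empirical_char: "even K \<Longrightarrow>
      cmod ((\<integral>\<omega>. \<Psi> \<omega> \<partial>\<Omega>) - (\<Sum>k\<le>K. (\<i> * of_real t) ^ k / fact k * of_real (expected_moment k n l)))
      \<le> 2 * \<bar>t\<bar> ^ K / fact K * expected_moment K n l"
proof -
  interpret prob_space \<Omega> by fact
  define X where "X = (\<lambda>k \<omega>. \<integral>x. x ^ k \<partial>empirical_spectral_distribution ((1 / sqrt l) \<cdot>\<^sub>m M \<omega>))"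
  have A: "(1 / sqrt l) \<cdot>\<^sub>m M \<omega> \<in> carrier_mat n n" if "\<omega> \<in> space \<Omega>" for \<omega>
    using erdos_renyi_adjacency_symmetric(1)[OF M that] by simp
  have iX: "integrable \<Omega> (X k)" and EX: "expectation (X k) = expected_moment k n l" for k
    unfolding X_def by (rule integrable_empirical_moment[OF M \<Omega>], rule expectation_empirical_moment[OF M \<Omega>])
  define S where "S = (\<lambda>K \<omega>. \<Sum>k\<le>K. (\<i> * of_real t) ^ k / fact k * complex_of_real (X k \<omega>))"
  have iS: "integrable \<Omega> (S K)" for K
    unfolding S_def using iX by auto
  have ES: "expectation (S K) = (\<Sum>k\<le>K. (\<i> * of_real t) ^ k / fact k * of_real (expected_moment k n l))" for K
    unfolding S_def using iX by (simp add: EX)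
  show meas: "\<Psi> \<in> borel_measurable \<Omega>"
  proof (rule borel_measurable_LIMSEQ_metric)
    show "S K \<in> borel_measurable \<Omega>" for K using iS by (rule borel_measurable_integrable)
    show "(\<lambda>K. S K \<omega>) \<longlonglongrightarrow> \<Psi> \<omega>" if "\<omega> \<in> space \<Omega>" for \<omega>
      using char_empirical_spectral_distribution_sums[OF A[OF that], of t]
      unfolding S_def \<Psi>_def X_def sums_def_le .
  qed
  have rd: "real_distribution (empirical_spectral_distribution ((1 / sqrt l) \<cdot>\<^sub>m M \<omega>))" if "\<omega> \<in> space \<Omega>" for \<omega>
    by (rule real_distribution_empirical_spectral_distribution[OF A[OF that] n])
  have i\<Psi>: "integrable \<Omega> \<Psi>"
  proof (rule integrable_const_bound[where B = 1])
    show "AE \<omega> in \<Omega>. cmod (\<Psi> \<omega>) \<le> 1"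
      unfolding \<Psi>_def using rd by (intro AE_I2 real_distribution.cmod_char_le_1) auto
  qed (rule meas)
  show "cmod (expectation \<Psi> - (\<Sum>k\<le>K. (\<i> * of_real t) ^ k / fact k * of_real (expected_moment k n l)))
      \<le> 2 * \<bar>t\<bar> ^ K / fact K * expected_moment K n l" if "even K"
  proof -
    have bound: "cmod (\<Psi> \<omega> - S K \<omega>) \<le> 2 * \<bar>t\<bar> ^ K / fact K * X K \<omega>" if "\<omega> \<in> space \<Omega>" for \<omega>
    proof -
      interpret D: real_distribution "empirical_spectral_distribution ((1 / sqrt l) \<cdot>\<^sub>m M \<omega>)"
        by (rule rd[OF that])
      have "integrable (empirical_spectral_distribution ((1 / sqrt l) \<cdot>\<^sub>m M \<omega>)) (\<lambda>x. x ^ k)" for k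
        by (rule integrable_empirical_spectral_distribution[OF A[OF that]]) simp
      from D.char_approx1[OF this, where n = K and t = t] show ?thesis
        using \<open>even K\<close> unfolding \<Psi>_def S_def X_def by (simp add: power_even_abs)
    qed
    have "cmod (expectation \<Psi> - expectation (S K)) = cmod (expectation (\<lambda>\<omega>. \<Psi> \<omega> - S K \<omega>))"
      using i\<Psi> iS by simp
    also have "\<dots> \<le> expectation (\<lambda>\<omega>. cmod (\<Psi> \<omega> - S K \<omega>))" by (rule integral_norm_bound)
    also have "\<dots> \<le> expectation (\<lambda>\<omega>. 2 * \<bar>t\<bar> ^ K / fact K * X K \<omega>)"
      using i\<Psi> iS iX bound by (intro integral_mono) auto
    also have "\<dots> = 2 * \<bar>t\<bar> ^ K / fact K * expected_moment K n l"
      by (simp add: EX)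
    finally show ?thesis unfolding ES .
  qed
qed

text \<open>Used to discard the indices \<open>n < l\<close>, for which \<open>l / n\<close> is not
  a probability.\<close>

lemma weak_conv_m_shift: "weak_conv_m \<mu> \<rho> \<Longrightarrow> weak_conv_m (\<lambda>n. \<mu> (n + N)) \<rho>"
  unfolding weak_conv_m_def weak_conv_def by (auto intro: LIMSEQ_ignore_initial_segment)

lemma cmod_ii_power: "cmod ((\<i> * of_real t) ^ k / fact k) = \<bar>t\<bar> ^ k / fact k"
  by (simp add: norm_divide norm_power norm_mult)

text \<open>Both characteristic functions are compared with the Taylor polynomial \<open>T\<close>
  built from the semicircle moments. The error sum comes from replacing expected moments by these,
  the last term from the two Taylor remainders.\<close>

lemma char_limit_near_semicircle:
  fixes M :: "nat \<Rightarrow> 'w \<Rightarrow> real mat"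
  assumes \<Omega>: "prob_space \<Omega>" and l: "l \<ge> 1"
    and M: "\<And>n. real n \<ge> l \<Longrightarrow> erdos_renyi_adjacency \<Omega> n (l / real n) (M n)"
    and \<nu>: "real_distribution \<nu>"
    and conv: "AE \<omega> in \<Omega>. weak_conv_m
      (\<lambda>n. empirical_spectral_distribution ((1 / sqrt l) \<cdot>\<^sub>m M n \<omega>)) \<nu>"
    and K: "even K"
  defines "C \<equiv> \<lambda>k. 2 * real (Suc (Suc k) * Suc k ^ Suc k)"
  shows "cmod (char \<nu> t - char semicircle_distribution t) \<le>
    (\<Sum>k\<le>K. \<bar>t\<bar> ^ k / fact k * (C k / sqrt l)) +
    2 * \<bar>t\<bar> ^ K / fact K * (2 * real (ballot_paths K 0) + C K / sqrt l)"
proof -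
  interpret prob_space \<Omega> by fact
  define b where "b = (\<lambda>k. real (ballot_paths k 0))"
  define T where "T = (\<Sum>k\<le>K. (\<i> * of_real t) ^ k / fact k * complex_of_real (b k))"
  define N where "N = nat \<lceil>l\<rceil>"
  have N: "l \<le> real (n + N)" "0 < n + N" for n unfolding N_def using l by linarith+
  define \<Psi> where "\<Psi> = (\<lambda>n \<omega>. char (empirical_spectral_distribution ((1 / sqrt l) \<cdot>\<^sub>m M (n + N) \<omega>)) t)"
  have rd: "real_distribution (empirical_spectral_distribution ((1 / sqrt l) \<cdot>\<^sub>m M (n + N) \<omega>))"
    if "\<omega> \<in> space \<Omega>" for n \<omega>
    using erdos_renyi_adjacency_symmetric(1)[OF M[OF N(1)] that] N(2)
    by (intro real_distribution_empirical_spectral_distribution[of _ "n + N"]) auto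
  \<comment> \<open>Weak convergence gives almost sure convergence of the bounded
    \<open>\<Psi> n\<close>; the limit is deterministic, so its expectation is itself.\<close>
  have "(\<lambda>n. expectation (\<Psi> n)) \<longlonglongrightarrow> expectation (\<lambda>_. char \<nu> t)"
  proof (rule integral_dominated_convergence[where w = "\<lambda>_. 1"])
    show "\<Psi> n \<in> borel_measurable \<Omega>" for n
      unfolding \<Psi>_def by (rule measurable_empirical_char[OF M[OF N(1)] \<Omega> N(2)])
    show "AE \<omega> in \<Omega>. (\<lambda>n. \<Psi> n \<omega>) \<longlonglongrightarrow> char \<nu> t"
      using conv AE_space
    proof eventually_elim
      case (elim \<omega>)
      from levy_continuity1[OF rd[OF elim(2)] \<nu> weak_conv_m_shift[OF elim(1), of N]]
      show ?case unfolding \<Psi>_def .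
    qed
    show "AE \<omega> in \<Omega>. norm (\<Psi> n \<omega>) \<le> 1" for n
      unfolding \<Psi>_def using rd by (intro AE_I2 real_distribution.cmod_char_le_1) auto
  qed auto
  then have lim: "(\<lambda>n. cmod (expectation (\<Psi> n) - T)) \<longlonglongrightarrow> cmod (char \<nu> t - T)"
    by (intro tendsto_intros) (simp add: prob_space)
  have "\<forall>\<^sub>F n in sequentially. \<forall>k\<in>{..K}. \<bar>expected_moment k n l - b k\<bar> \<le> C k / sqrt l"
    unfolding b_def C_def by (intro eventually_ball_finite ballI eventually_expected_moment l) auto
  then have "\<forall>\<^sub>F n in sequentially. \<forall>k\<in>{..K}. \<bar>expected_moment k (n + N) l - b k\<bar> \<le> C k / sqrt l"
    by (rule sequentially_offset)
  then have "\<forall>\<^sub>F n in sequentially. cmod (expectation (\<Psi> n) - T) \<le>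
    (\<Sum>k\<le>K. \<bar>t\<bar> ^ k / fact k * (C k / sqrt l)) + 2 * \<bar>t\<bar> ^ K / fact K * (b K + C K / sqrt l)"
  proof eventually_elim
    case (elim n)
    let ?e = "\<lambda>k. expected_moment k (n + N) l"
    let ?S = "\<Sum>k\<le>K. (\<i> * of_real t) ^ k / fact k * complex_of_real (?e k)"
    have "cmod (expectation (\<Psi> n) - ?S) \<le> 2 * \<bar>t\<bar> ^ K / fact K * ?e K"
      unfolding \<Psi>_def by (rule expectation_empirical_char[OF M[OF N(1)] \<Omega> N(2) K])
    also have "\<dots> \<le> 2 * \<bar>t\<bar> ^ K / fact K * (b K + C K / sqrt l)"
      using elim[rule_format, of K] by (intro mult_left_mono) auto
    finally have 1: "cmod (expectation (\<Psi> n) - ?S) \<le> 2 * \<bar>t\<bar> ^ K / fact K * (b K + C K / sqrt l)" .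
    have "?S - T = (\<Sum>k\<le>K. (\<i> * of_real t) ^ k / fact k * complex_of_real (?e k - b k))"
      unfolding T_def by (simp add: sum_subtractf[symmetric] ring_distribs)
    also have "cmod \<dots> \<le> (\<Sum>k\<le>K. cmod ((\<i> * of_real t) ^ k / fact k * complex_of_real (?e k - b k)))"
      by (rule norm_sum)
    also have "\<dots> \<le> (\<Sum>k\<le>K. \<bar>t\<bar> ^ k / fact k * (C k / sqrt l))"
      unfolding norm_mult cmod_ii_power norm_of_real
      using elim by (intro sum_mono mult_left_mono) auto
    finally have 2: "cmod (?S - T) \<le> (\<Sum>k\<le>K. \<bar>t\<bar> ^ k / fact k * (C k / sqrt l))" .
    show ?case using norm_triangle_ineq[of "expectation (\<Psi> n) - ?S" "?S - T"] 1 2 by simp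
  qed
  from tendsto_upperbound[OF lim this]
  have 1: "cmod (char \<nu> t - T) \<le>
    (\<Sum>k\<le>K. \<bar>t\<bar> ^ k / fact k * (C k / sqrt l)) + 2 * \<bar>t\<bar> ^ K / fact K * (b K + C K / sqrt l)"
    by simp
  interpret S: real_distribution semicircle_distribution by (rule real_distribution_semicircle)
  \<comment> \<open>This remainder supplies the second copy of \<open>b K\<close> in the
    claim.\<close>
  have "cmod (char semicircle_distribution t - T) \<le> 2 * \<bar>t\<bar> ^ K / fact K * b K"
    using S.char_approx1[OF integrable_semicircle_power, where n = K and t = t] K
    by (simp add: moment_semicircle power_even_abs T_def b_def)
  with 1 norm_triangle_ineq4[of "char \<nu> t - T" "char semicircle_distribution t - T"]
  show ?thesis by (simp add: b_def ring_distribs)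
qed

section \<open>Convergence to the semicircle distribution by Levy's continuity theorem\<close>

theorem theorem1p1:
  fixes \<Omega> :: "'w measure"
    and M :: "nat \<Rightarrow> real \<Rightarrow> 'w \<Rightarrow> real mat"
    and \<nu> :: "real \<Rightarrow> real measure"
  assumes "prob_space \<Omega>"
    and "\<And>n p. 0 \<le> p \<Longrightarrow> p \<le> 1 \<Longrightarrow> erdos_renyi_adjacency \<Omega> n p (M n p)"
    and "\<And>l. l > 0 \<Longrightarrow> real_distribution (\<nu> l)"
    and "\<And>l. l > 0 \<Longrightarrow> (AE \<omega> in \<Omega>. weak_conv_m
           (\<lambda>n. empirical_spectral_distribution ((1 / sqrt l) \<cdot>\<^sub>m M n (l / real n) \<omega>)) (\<nu> l))"
  shows "weakly_tendsto \<nu> semicircle_distribution at_top"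
proof -
  have char: "((\<lambda>l. char (\<nu> l) t) \<longlongrightarrow> char semicircle_distribution t) at_top" for t
  proof (rule tendstoI)
    fix \<epsilon> :: real assume "\<epsilon> > 0"
    have "(\<lambda>n. inverse (fact n) * (2 * \<bar>t\<bar>) ^ n) \<longlonglongrightarrow> 0"
      by (rule summable_LIMSEQ_zero[OF summable_exp])
    then have "\<forall>\<^sub>F n in sequentially. inverse (fact n) * (2 * \<bar>t\<bar>) ^ n < \<epsilon> / 4"
      using \<open>\<epsilon> > 0\<close> by (intro order_tendstoD) auto
    then obtain K0 where "\<And>n. n \<ge> K0 \<Longrightarrow> inverse (fact n) * (2 * \<bar>t\<bar>) ^ n < \<epsilon> / 4"
      by (auto simp: eventually_sequentially)
    \<comment> \<open>Taking twice the threshold gives an even order.\<close>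
    then obtain K where K: "even K" "inverse (fact K) * (2 * \<bar>t\<bar>) ^ K < \<epsilon> / 4"
      by (metis dvd_triv_left le_add2 mult_2)
    define C where "C = (\<lambda>k. 2 * real (Suc (Suc k) * Suc k ^ Suc k))"
    define b where "b = real (ballot_paths K 0)"
    define R where "R = (\<lambda>l. (\<Sum>k\<le>K. \<bar>t\<bar> ^ k / fact k * (C k / sqrt l)) +
      2 * \<bar>t\<bar> ^ K / fact K * (2 * b + C K / sqrt l))"
    have sq: "((\<lambda>l. c / sqrt l) \<longlongrightarrow> 0) at_top" for c
      by (intro tendsto_divide_0[OF tendsto_const] filterlim_at_top_imp_at_infinity sqrt_at_top)
    have R: "(R \<longlongrightarrow> (\<Sum>k\<le>K. \<bar>t\<bar> ^ k / fact k * 0) + 2 * \<bar>t\<bar> ^ K / fact K * (2 * b + 0)) at_top"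
      unfolding R_def by (intro tendsto_intros sq)
    \<comment> \<open>The limit of \<open>R\<close> is at most 4 times the quantity that was chosen
      below \<open>\<epsilon> / 4\<close>.\<close>
    have "2 * \<bar>t\<bar> ^ K / fact K * (2 * b) \<le> 4 * (inverse (fact K) * (2 * \<bar>t\<bar>) ^ K)"
    proof -
      have "b \<le> 2 ^ K"
        unfolding b_def using ballot_paths_le[of K 0] by (metis of_nat_le_iff of_nat_numeral of_nat_power)
      then have "2 * \<bar>t\<bar> ^ K / fact K * (2 * b) \<le> 2 * \<bar>t\<bar> ^ K / fact K * (2 * 2 ^ K)"
        by (intro mult_left_mono) auto
      then show ?thesis by (simp add: power_mult_distrib divide_inverse mult_ac)
    qed
    with K(2) have "\<forall>\<^sub>F l in at_top. R l < \<epsilon>"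
      by (intro order_tendstoD(2)[OF R]) simp
    moreover have "\<forall>\<^sub>F l::real in at_top. l \<ge> 1" by (rule eventually_ge_at_top)
    ultimately show "\<forall>\<^sub>F l in at_top. dist (char (\<nu> l) t) (char semicircle_distribution t) < \<epsilon>"
    proof eventually_elim
      case (elim l)
      have "cmod (char (\<nu> l) t - char semicircle_distribution t) \<le> R l"
        unfolding R_def b_def C_def
        by (rule char_limit_near_semicircle[OF assms(1) elim(2) _ assms(3) assms(4) K(1)])
          (use elim assms(2) in auto)
      with elim(1) show ?case by (simp add: dist_norm)
    qed
  qed
  show ?thesis
    unfolding weakly_tendsto_def
  proof (intro allI impI tendsto_at_topI_sequentially)
    fix f :: "real \<Rightarrow> real" and X :: "nat \<Rightarrow> real"
    assume f: "continuous_on UNIV f \<and> bounded (range f)" and X: "filterlim X at_top sequentially"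
    \<comment> \<open>Levy's theorem concerns sequences, so the limit is tested along an arbitrary
      \<open>X\<close> tending to infinity, shifted until it is positive so that every
      \<open>\<nu> (X (n + N))\<close> is a distribution.\<close>
    have "\<forall>\<^sub>F n in sequentially. 0 < X n"
      using X by (simp add: filterlim_at_top_dense)
    then obtain N where N: "\<And>n. 0 < X (n + N)"
      by (auto simp: eventually_sequentially) (metis le_add2)
    let ?\<mu> = "\<lambda>n. \<nu> (X (n + N))"
    have XN: "filterlim (\<lambda>n. X (n + N)) at_top sequentially"
      by (rule filterlim_compose[OF X filterlim_add_const_nat_at_top])
    have rd: "real_distribution (?\<mu> n)" for n using assms(3) N by blast
    have "weak_conv_m ?\<mu> semicircle_distribution"
      by (rule levy_continuity[OF rd real_distribution_semicircle filterlim_compose[OF char XN]])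
    then have "weakly_tendsto ?\<mu> semicircle_distribution sequentially"
      using weakly_tendsto_sequentially_iff_weak_conv_m[of ?\<mu>, OF rd real_distribution_semicircle]
      by blast
    then have "(\<lambda>n. integral\<^sup>L (?\<mu> n) f) \<longlonglongrightarrow> integral\<^sup>L semicircle_distribution f"
      using f unfolding weakly_tendsto_def by blast
    then show "(\<lambda>n. integral\<^sup>L (\<nu> (X n)) f) \<longlonglongrightarrow> integral\<^sup>L semicircle_distribution f"
      by (rule LIMSEQ_offset)
  qed
qed

end
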